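(* Let $\gamma\in\mathbb{H}$ and let $X_1,X_2,\dots$ be i.i.d. Cauchy random variables with complex parameter $\gamma$. For $p\in[-1,0)$ and $\alpha\in\overline{\mathbb{H}}$ let $f(x)=(x+\alpha)^p$ and $M^f_n=\left(\frac1n\sum_{j=1}^n (X_j+\alpha)^p\right)^{1/p}-\alpha$. Let $n\ge2$. Then: (i) Let $p\in(-1,0)$ and $\alpha\in\overline{\mathbb{H}}$. Then $M^f_n\in L^1$ and $E[M^f_n]=\gamma$. (ii) Let $p=-1$ and $\alpha\in\mathbb{R}$. Then $M^f_n\notin L^1$. (iii) Let $p=-1$ and $\alpha\in\mathbb{H}$. Then $M^f_n\in L^1$ and $E[M^f_n]=\gamma$.
   Context: $\mathbb{H}=\{z\in\mathbb{C}:\mathrm{Im}(z)>0\}$ and $\overline{\mathbb{H}}=\{z\in\mathbb{C}:\mathrm{Im}(z)\ge0\}$. The Cauchy distribution with complex parameter $\gamma=\mu+i\sigma$, $\mu\in\mathbb{R}$, $\sigma>0$, has density $p_\gamma(x)=\frac{\sigma}{\pi}\frac{1}{(x-\mu)^2+\sigma^2}$ on $\mathbb{R}$. Complex powers use the principal branch: $z^q=\exp(q\log z)$ with $\log z=\log r+i\theta$ for $z=r e^{i\theta}$, $r>0$, $\theta\in(-\pi,\pi]$. $Y\in L^1$ means $E[|Y|]<+\infty$, and $E[Y]=E[\mathrm{Re}(Y)]+iE[\mathrm{Im}(Y)]$. $M_n^f$ is almost surely well defined. *)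

theory Defs
  imports "HOL-Probability.Probability"
begin

definition cauchy_density :: "complex \<Rightarrow> real \<Rightarrow> real" where
  "cauchy_density \<gamma> x = Im \<gamma> / pi * (1 / ((x - Re \<gamma>)\<^sup>2 + (Im \<gamma>)\<^sup>2))"

(* Complex powr is the principal branch (arguments in (-pi, pi]), with the library convention
   0 powr q = 0. Under the Cauchy law the base of each power is almost surely nonzero, so this
   convention only affects a null set. *)
definition shifted_power_mean ::
  "real \<Rightarrow> complex \<Rightarrow> (nat \<Rightarrow> 'a \<Rightarrow> real) \<Rightarrow> nat \<Rightarrow> 'a \<Rightarrow> complex" where
  "shifted_power_mean p \<alpha> X n \<omega> =
     (1 / of_nat n * (\<Sum>j=1..n. (of_real (X j \<omega>) + \<alpha>) powr of_real p)) powr of_real (1 / p) - \<alpha>"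

(* For measurable X j the mean is measurable, so "not integrable" for it means exactly that the
   expectation of its modulus is infinite. *)
lemma borel_measurable_powr_complex:
  fixes f :: "'a \<Rightarrow> complex" and q :: complex
  assumes [measurable]: "f \<in> borel_measurable M"
  shows "(\<lambda>x. f x powr q) \<in> borel_measurable M"
proof -
  have "(\<lambda>z. indicator (- \<real>\<^sub>\<le>\<^sub>0) z *\<^sub>R Ln z) \<in> borel_measurable borel"
    by (intro borel_measurable_continuous_on_indicator continuous_on_Ln borel_comp
        borel_closed) auto
  then have 1: "(\<lambda>x. indicator (- \<real>\<^sub>\<le>\<^sub>0) (f x) *\<^sub>R Ln (f x)) \<in> borel_measurable M"
    by (rule measurable_compose[OF assms])
  have "(\<lambda>x. f x powr q) = (\<lambda>x. if f x = 0 then 0 else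
      exp (q * (if Im (f x) = 0 \<and> Re (f x) \<le> 0
        then of_real (ln (- Re (f x))) + \<i> * of_real pi
        else indicator (- \<real>\<^sub>\<le>\<^sub>0) (f x) *\<^sub>R Ln (f x))))"
  proof
    fix x
    have "Ln (f x) = of_real (ln (- Re (f x))) + \<i> * of_real pi"
      if "Im (f x) = 0" "Re (f x) \<le> 0" "f x \<noteq> 0"
    proof -
      have *: "Re (f x) < 0"
        using that by (auto simp: complex_eq_iff)
      have "- f x = of_real (- Re (f x))"
        using that by (simp add: complex_eq_iff)
      moreover have "Ln (of_real (- Re (f x))) = of_real (ln (- Re (f x)))"
        using * by (intro Ln_of_real) simp
      moreover have "Ln (- f x) = Ln (f x) - \<i> * of_real pi"
        using Ln_minus[of "f x"] that * by simp
      ultimately show ?thesis by (metis diff_add_cancel)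
    qed
    then show "f x powr q = (if f x = 0 then 0 else
      exp (q * (if Im (f x) = 0 \<and> Re (f x) \<le> 0
        then of_real (ln (- Re (f x))) + \<i> * of_real pi
        else indicator (- \<real>\<^sub>\<le>\<^sub>0) (f x) *\<^sub>R Ln (f x))))"
      by (auto simp: powr_def complex_nonpos_Reals_iff indicator_def)
  qed
  also have "\<dots> \<in> borel_measurable M"
    using 1 by measurable
  finally show ?thesis .
qed

lemma borel_measurable_shifted_power_mean:
  assumes "\<And>j. j \<ge> 1 \<Longrightarrow> X j \<in> borel_measurable M"
  shows "shifted_power_mean p \<alpha> X n \<in> borel_measurable M"
proof -
  have "(\<lambda>\<omega>. complex_of_real (X j \<omega>)) \<in> borel_measurable M" if "j \<in> {1..n}" for j
    using that by (intro measurable_compose[OF assms borel_measurable_of_real]) auto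
  then show ?thesis
    unfolding shifted_power_mean_def[abs_def]
    by (intro borel_measurable_diff borel_measurable_powr_complex borel_measurable_times
        borel_measurable_sum borel_measurable_add borel_measurable_const)
qed

end

theory Submission
  imports Defs "HOL-Complex_Analysis.Complex_Analysis"
begin

text \<open>
  The Cauchy density with parameter \<open>\<gamma>\<close> is the Poisson kernel of the upper half-plane \<open>H\<close> at the
  point \<open>\<gamma>\<close>. Hence a bounded function \<open>g\<close> that is continuous on the closed half-plane and holomorphic
  inside satisfies \<open>E[g(X)] = g(\<gamma>)\<close> (\<open>poisson_formula\<close>), and integrating out one variable after the
  other gives \<open>E[F(X\<^sub>1, \<dots>, X\<^sub>n)] = F(\<gamma>, \<dots>, \<gamma>)\<close> for bounded, separately holomorphic \<open>F\<close>
  (\<open>poisson_formula_PiM\<close>). The power mean is separately holomorphic and takes the value \<open>\<gamma> + \<alpha>\<close> at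
  \<open>(\<gamma>, \<dots>, \<gamma>)\<close>; what has to be dealt with is that it is unbounded, and singular on the boundary when
  \<open>\<alpha>\<close> is real.

  For \<open>-1 \<le> p < 0\<close> the powers \<open>z\<^sup>p\<close> of \<open>z\<close> in the closed half-plane lie in the sector of arguments
  \<open>[p\<pi>, 0]\<close>, whose bisector is spanned by \<open>u = exp(i p \<pi>/2)\<close> and whose half-opening is at most \<open>\<pi>/2\<close>.
  So does their average \<open>G\<close>, and \<open>|G + \<delta>u|\<close> is at least \<open>\<delta>\<close> and at least \<open>|G|\<close>. The regularised mean
  \<open>(G + \<delta>u)\<^sup>1\<^sup>/\<^sup>p\<close> is therefore bounded, and dominated by the power mean itself. The Poisson formula
  applies to it, first with \<open>\<alpha>\<close> moved into the interior (\<open>expectation_regularised_mean\<close>). Letting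
  \<open>\<delta>\<close> tend to 0 by dominated convergence shows that an integrable power mean has expectation
  \<open>\<gamma> + \<alpha>\<close> (\<open>expectation_power_mean\<close>). Only integrability remains to be decided.

  For \<open>p > -1\<close> the sector has opening less than \<open>\<pi>\<close>, so there is no cancellation in the sum and
  the power mean is at most a constant times each single \<open>|X\<^sub>j + \<alpha>|\<close>. As \<open>n \<ge> 2\<close>, it is bounded by a
  multiple of the square root of \<open>|X\<^sub>1 + \<alpha>| |X\<^sub>2 + \<alpha>|\<close>, and Cauchy variables have a moment of order 1/2.

  For \<open>p = -1\<close> and \<open>\<alpha>\<close> in \<open>H\<close>, \<open>h = 1/(s + 1/(X\<^sub>1 + \<alpha>))\<close> takes values in \<open>H\<close> for every \<open>s\<close> in the
  lower half-plane, where \<open>s\<close> collects the terms of the other variables. A function with values in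
  \<open>H\<close> has moments of order \<open>q < 1\<close> that are controlled by its value at \<open>\<gamma>\<close>, because \<open>h\<^sup>q\<close> stays in a
  sector of opening less than \<open>\<pi>\<close> (\<open>fractional_moment_bound\<close>); this gives a bound that is uniform
  in \<open>s\<close>. The remaining factor \<open>|h|\<^sup>1\<^sup>/\<^sup>4\<close> is at most a constant times \<open>|X\<^sub>2 + \<alpha>|\<^sup>1\<^sup>/\<^sup>2\<close>, which is integrable
  and independent of \<open>X\<^sub>1\<close>. The finiteness of the moment of order 1/2 is the limit \<open>s \<rightarrow> 0\<close> of the same
  bound.

  For \<open>p = -1\<close> and real \<open>\<alpha>\<close> the harmonic mean is real, so if it were integrable its expectation
  could not be \<open>\<gamma> + \<alpha>\<close>.
\<close>

section \<open>The Cauchy law as the Poisson kernel of the upper half-plane\<close>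

definition cauchy_law :: "complex \<Rightarrow> real measure" where
  "cauchy_law \<gamma> = density lborel (\<lambda>x. ennreal (cauchy_density \<gamma> x))"

lemma sets_cauchy_law [simp, measurable_cong]: "sets (cauchy_law \<gamma>) = sets borel"
  and space_cauchy_law [simp]: "space (cauchy_law \<gamma>) = UNIV"
  by (simp_all add: cauchy_law_def)

lemma borel_measurable_cauchy_density [measurable]: "cauchy_density \<gamma> \<in> borel_measurable borel"
  unfolding cauchy_density_def[abs_def] by measurable

lemma cauchy_density_nonneg: "Im \<gamma> > 0 \<Longrightarrow> 0 \<le> cauchy_density \<gamma> x"
  by (simp add: cauchy_density_def)

lemma prob_space_cauchy_law:
  assumes "Im \<gamma> > 0"
  shows "prob_space (cauchy_law \<gamma>)"
proof -
  define F where "F x = arctan ((x - Re \<gamma>) / Im \<gamma>) / pi" for x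
  have der: "DERIV F x :> cauchy_density \<gamma> x" for x
  proof -
    have "1 / (1 + ((x - Re \<gamma>) / Im \<gamma>)\<^sup>2) / Im \<gamma> = Im \<gamma> / ((x - Re \<gamma>)\<^sup>2 + (Im \<gamma>)\<^sup>2)"
    proof -
      have "1 + ((x - Re \<gamma>) / Im \<gamma>)\<^sup>2 = ((x - Re \<gamma>)\<^sup>2 + (Im \<gamma>)\<^sup>2) / (Im \<gamma>)\<^sup>2"
        using assms by (simp add: power_divide add_divide_distrib)
      then show ?thesis using assms by (simp add: power2_eq_square)
    qed
    then show ?thesis
      unfolding F_def cauchy_density_def using assms
      by (auto intro!: derivative_eq_intros simp: inverse_eq_divide)
  qed
  have top: "(F \<longlongrightarrow> 1/2) at_top"
  proof -
    have "filterlim (\<lambda>x. (x - Re \<gamma>) / Im \<gamma>) at_top at_top"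
      using assms by real_asymp
    then have "((\<lambda>x. arctan ((x - Re \<gamma>) / Im \<gamma>) / pi) \<longlongrightarrow> (pi/2) / pi) at_top"
      by (intro tendsto_intros filterlim_compose[OF tendsto_arctan_at_top]) auto
    then show ?thesis by (simp add: F_def[abs_def])
  qed
  have bot: "(F \<longlongrightarrow> -1/2) at_bot"
  proof -
    have "filterlim (\<lambda>x. (x - Re \<gamma>) / Im \<gamma>) at_bot at_bot"
      using assms by real_asymp
    then have "((\<lambda>x. arctan ((x - Re \<gamma>) / Im \<gamma>) / pi) \<longlongrightarrow> (-(pi/2)) / pi) at_bot"
      by (intro tendsto_intros filterlim_compose[OF tendsto_arctan_at_bot]) auto
    then show ?thesis by (simp add: F_def[abs_def])
  qed
  have cont: "isCont (cauchy_density \<gamma>) x" for x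
    unfolding cauchy_density_def[abs_def] using assms
    by (auto intro!: continuous_intros simp: add_nonneg_eq_0_iff)
  note FTC = interval_integral_FTC_nonneg[of "-\<infinity>" \<infinity> F "cauchy_density \<gamma>" "-1/2" "1/2",
      OF _ der cont]
  have 1: "integrable lborel (cauchy_density \<gamma>)" "(LBINT x. cauchy_density \<gamma> x) = 1"
    using FTC top bot cauchy_density_nonneg[OF assms]
    by (simp_all add: set_integrable_def ereal_tendsto_simps interval_lebesgue_integral_def
        set_lebesgue_integral_def)
  have "emeasure (cauchy_law \<gamma>) UNIV = (\<integral>\<^sup>+x. ennreal (cauchy_density \<gamma> x) \<partial>lborel)"
    by (simp add: cauchy_law_def emeasure_density)
  also have "\<dots> = 1"
    using 1 cauchy_density_nonneg[OF assms] by (subst nn_integral_eq_integral) auto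
  finally show ?thesis by (intro prob_spaceI) simp
qed

lemma AE_cauchy_law_neq: "AE x in cauchy_law \<gamma>. x \<noteq> c"
  unfolding cauchy_law_def
  by (subst AE_density) (use AE_lborel_singleton[of c] in \<open>auto elim: eventually_mono\<close>)

text \<open>This form exhibits the density as the boundary value of a rational function whose only pole in
  the upper half-plane is \<open>\<gamma>\<close>.\<close>

lemma cauchy_density_partial_fraction:
  assumes "Im \<gamma> > 0"
  shows "complex_of_real (cauchy_density \<gamma> x) =
    of_real (Im \<gamma> / pi) / ((of_real x - \<gamma>) * (of_real x - cnj \<gamma>))"
proof -
  have "(of_real x - \<gamma>) * (of_real x - cnj \<gamma>) = complex_of_real ((x - Re \<gamma>)\<^sup>2 + (Im \<gamma>)\<^sup>2)"
    by (auto simp: complex_eq_iff power2_eq_square algebra_simps)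
  then show ?thesis by (simp add: cauchy_density_def)
qed

lemma convex_Im_ge: "convex {z. Im z \<ge> 0}"
  using convex_halfspace_ge[of 0 \<i>] by (simp add: inner_complex_def)

text \<open>
  The function \<open>k(w) = (g(w) - g(\<gamma>)) / ((w - cnj \<gamma>) (w - \<gamma>))\<close> has a removable singularity at \<open>\<gamma>\<close>, so
  its integral over the boundary of a large half-disc vanishes. It is \<open>O(1/|w|\<^sup>2)\<close> since \<open>g\<close> is
  bounded, so the arc contributes nothing in the limit, and on the real line it is a multiple of the
  density times \<open>g - g(\<gamma>)\<close>.
\<close>

theorem poisson_formula:
  assumes \<gamma>: "Im \<gamma> > 0"
    and cont: "continuous_on {z. Im z \<ge> 0} g"
    and hol: "g holomorphic_on {z. Im z > 0}"
    and bdd: "\<And>z. Im z \<ge> 0 \<Longrightarrow> cmod (g z) \<le> B"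
  shows "integrable (cauchy_law \<gamma>) (\<lambda>x. g (of_real x))"
    and "(\<integral>x. g (of_real x) \<partial>cauchy_law \<gamma>) = g \<gamma>"
proof -
  interpret N: prob_space "cauchy_law \<gamma>" by (rule prob_space_cauchy_law[OF \<gamma>])
  have "continuous_on UNIV (\<lambda>x. g (complex_of_real x))"
    by (intro continuous_on_compose2[OF cont]) (auto intro!: continuous_intros)
  then have meas [measurable]: "(\<lambda>x. g (complex_of_real x)) \<in> borel_measurable borel"
    by (rule borel_measurable_continuous_onI)
  show int: "integrable (cauchy_law \<gamma>) (\<lambda>x. g (of_real x))"
    by (rule N.integrable_const_bound[where B = B]) (auto simp: bdd)
  define k where "k w = (g w - g \<gamma>) / (w - cnj \<gamma>) / (w - \<gamma>)" for w
  have ne: "w \<noteq> cnj \<gamma>" if "Im w \<ge> 0" for w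
    using that \<gamma> by auto
  have B0: "B \<ge> 0" using order_trans[OF norm_ge_zero bdd[of 0]] by simp
  have bound: "norm (\<integral>x. indicator {-R..R} x *\<^sub>R (g (of_real x) - g \<gamma>) \<partial>cauchy_law \<gamma>)
      \<le> 2 * B * Im \<gamma> * R / (R - cmod \<gamma>)\<^sup>2" if R: "R > cmod \<gamma>" for R
  proof -
    have R0: "R > 0" using R norm_ge_zero[of \<gamma>] by linarith
    let ?arc = "part_circlepath 0 R 0 pi" and ?line = "linepath (of_real (-R)) (of_real R)"
    have arc: "cmod w = R \<and> Im w \<ge> 0" if "w \<in> path_image ?arc" for w
      using that R0 by (auto simp: path_image_part_circlepath norm_mult Im_exp intro!: sin_ge_zero mult_nonneg_nonneg)
    have line: "Im w = 0" if "w \<in> path_image ?line" for w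
      using that by (auto simp: closed_segment_def)
    have ends: "pathfinish ?arc = pathstart ?line" "pathfinish ?line = pathstart ?arc"
      by auto
    have path: "path_image (?arc +++ ?line) \<subseteq> {z. Im z \<ge> 0} - {\<gamma>}"
    proof
      fix w assume "w \<in> path_image (?arc +++ ?line)"
      then consider "w \<in> path_image ?arc" | "w \<in> path_image ?line"
        using ends by (auto simp: path_image_join)
      then show "w \<in> {z. Im z \<ge> 0} - {\<gamma>}"
        using arc[of w] line[of w] R \<gamma> by cases auto
    qed
    have interior: "interior {z. Im z \<ge> 0} = {z. Im z > 0}"
      using interior_halfspace_ge[of \<i> 0] by (simp add: inner_complex_def)
    have "(\<lambda>w. (g w - g \<gamma>) / (w - cnj \<gamma>)) holomorphic_on {z. Im z > 0}"
      using ne by (intro holomorphic_intros hol) auto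
    then have diff: "(\<lambda>w. (g w - g \<gamma>) / (w - cnj \<gamma>)) field_differentiable at w" if "Im w > 0" for w
      using that open_halfspace_Im_gt[of 0] by (intro holomorphic_on_imp_differentiable_at) auto
    \<comment> \<open>The integrand vanishes at \<open>\<gamma>\<close> before division by \<open>w - \<gamma>\<close>, so the value of the winding number,
        which Cauchy's formula carries as a factor, never has to be computed.\<close>
    have "((\<lambda>w. (g w - g \<gamma>) / (w - cnj \<gamma>) / (w - \<gamma>)) has_contour_integral
        (2 * pi * \<i> * winding_number (?arc +++ ?line) \<gamma> * ((g \<gamma> - g \<gamma>) / (\<gamma> - cnj \<gamma>))))
        (?arc +++ ?line)"
    proof (rule Cauchy_integral_formula_weak[where S = "{z. Im z \<ge> 0}" and k = "{}"])
      show "continuous_on {z. Im z \<ge> 0} (\<lambda>w. (g w - g \<gamma>) / (w - cnj \<gamma>))"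
        using ne by (intro continuous_intros cont) auto
      show "valid_path (?arc +++ ?line)"
        using ends by (intro valid_path_join) auto
    qed (use convex_Im_ge interior \<gamma> diff path in auto)
    then have 0: "(k has_contour_integral 0) (?arc +++ ?line)"
      by (simp add: k_def[abs_def])
    then have int: "k contour_integrable_on ?arc" "k contour_integrable_on ?line"
      using ends contour_integrable_joinD1[of k ?arc ?line] contour_integrable_joinD2[of k ?arc ?line]
      by (auto simp: contour_integrable_on_def)
    then have sum: "contour_integral ?arc k + contour_integral ?line k = 0"
      using 0 ends by (metis contour_integral_join contour_integral_unique valid_path_linepath
          valid_path_part_circlepath)
    have "cmod (k w) \<le> 2 * B / (R - cmod \<gamma>)\<^sup>2" if "w \<in> path_image ?arc" for w
    proof -
      have "cmod (g w - g \<gamma>) \<le> 2 * B"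
        using arc[OF that] bdd[of w] bdd[of \<gamma>] \<gamma> norm_triangle_ineq4[of "g w" "g \<gamma>"] by linarith
      moreover have "R - cmod \<gamma> \<le> cmod (w - \<gamma>)" "R - cmod \<gamma> \<le> cmod (w - cnj \<gamma>)"
        using arc[OF that] norm_triangle_ineq2[of w \<gamma>] norm_triangle_ineq2[of w "cnj \<gamma>"] by auto
      moreover from this have "(R - cmod \<gamma>)\<^sup>2 \<le> cmod (w - cnj \<gamma>) * cmod (w - \<gamma>)"
        using R unfolding power2_eq_square by (intro mult_mono) auto
      ultimately show ?thesis
        using R B0 unfolding k_def norm_divide divide_divide_eq_left norm_mult
        by (intro frac_le) auto
    qed
    then have arc_bound: "cmod (contour_integral ?arc k) \<le> 2 * B / (R - cmod \<gamma>)\<^sup>2 * R * \<bar>pi - 0\<bar>"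
      using R0 B0 by (intro contour_integral_bound_part_circlepath int) auto
    have "contour_integral ?line k = integral {-R..R} (\<lambda>x. k (of_real x))"
      using R0 by (subst contour_integral_linepath_Reals_eq) auto
    also have "\<dots> = (LINT x:{-R..R}|lborel. k (of_real x))"
    proof (rule set_borel_integral_eq_integral(2)[symmetric])
      have "of_real x \<noteq> \<gamma>" for x using \<gamma> by auto
      then have "continuous_on {-R..R} (\<lambda>x. k (of_real x))"
        unfolding k_def using ne
        by (intro continuous_intros continuous_on_compose2[OF cont]) auto
      then show "set_integrable lborel {-R..R} (\<lambda>x. k (of_real x))"
        by (intro borel_integrable_atLeastAtMost') auto
    qed
    also have "\<dots> = of_real (pi / Im \<gamma>) *
        (LINT x:{-R..R}|lborel. cauchy_density \<gamma> x *\<^sub>R (g (of_real x) - g \<gamma>))"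
      unfolding set_integral_mult_right[symmetric]
      by (intro set_lebesgue_integral_cong)
        (use \<gamma> in \<open>auto simp: k_def scaleR_conv_of_real cauchy_density_partial_fraction\<close>)
    also have "(LINT x:{-R..R}|lborel. cauchy_density \<gamma> x *\<^sub>R (g (of_real x) - g \<gamma>)) =
        (\<integral>x. indicator {-R..R} x *\<^sub>R (g (of_real x) - g \<gamma>) \<partial>cauchy_law \<gamma>)" (is "_ = ?I")
      unfolding cauchy_law_def set_lebesgue_integral_def using \<gamma>
      by (subst integral_density) (auto simp: cauchy_density_nonneg mult.commute)
    finally have "cmod ?I = Im \<gamma> / pi * cmod (contour_integral ?line k)"
      using \<gamma> by (simp add: norm_mult norm_divide)
    also have "cmod (contour_integral ?line k) = cmod (contour_integral ?arc k)"
      using sum by (metis add.inverse_unique norm_minus_cancel)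
    also have "Im \<gamma> / pi * \<dots> \<le> Im \<gamma> / pi * (2 * B / (R - cmod \<gamma>)\<^sup>2 * R * \<bar>pi - 0\<bar>)"
      using \<gamma> by (intro mult_left_mono arc_bound) auto
    finally show ?thesis by (simp add: field_simps)
  qed
  have "(\<lambda>n. \<integral>x. indicator {-real n..real n} x *\<^sub>R (g (of_real x) - g \<gamma>) \<partial>cauchy_law \<gamma>)
      \<longlonglongrightarrow> (\<integral>x. g (of_real x) - g \<gamma> \<partial>cauchy_law \<gamma>)"
  proof (rule integral_dominated_convergence[where w = "\<lambda>x. norm (g (of_real x) - g \<gamma>)"])
    show "AE x in cauchy_law \<gamma>. (\<lambda>n. indicator {-real n..real n} x *\<^sub>R (g (of_real x) - g \<gamma>))
        \<longlonglongrightarrow> g (of_real x) - g \<gamma>"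
    proof (rule AE_I2, rule tendsto_eventually)
      fix x :: real
      have "eventually (\<lambda>n. real n \<ge> \<bar>x\<bar>) sequentially" by real_asymp
      then show "eventually (\<lambda>n. indicator {-real n..real n} x *\<^sub>R (g (of_real x) - g \<gamma>)
          = g (of_real x) - g \<gamma>) sequentially"
        by eventually_elim (auto simp: indicator_def)
    qed
  qed (use int in \<open>auto simp: indicator_def\<close>)
  moreover have "(\<lambda>n. \<integral>x. indicator {-real n..real n} x *\<^sub>R (g (of_real x) - g \<gamma>) \<partial>cauchy_law \<gamma>)
      \<longlonglongrightarrow> 0"
  proof (rule Lim_null_comparison)
    have "eventually (\<lambda>n. real n > cmod \<gamma>) sequentially" by real_asymp
    then show "eventually (\<lambda>n. norm (\<integral>x. indicator {-real n..real n} x *\<^sub>R (g (of_real x) - g \<gamma>)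
        \<partial>cauchy_law \<gamma>) \<le> 2 * B * Im \<gamma> * real n / (real n - cmod \<gamma>)\<^sup>2) sequentially"
      by eventually_elim (rule bound)
    show "(\<lambda>n. 2 * B * Im \<gamma> * real n / (real n - cmod \<gamma>)\<^sup>2) \<longlonglongrightarrow> 0" by real_asymp
  qed
  ultimately have "(\<integral>x. g (of_real x) - g \<gamma> \<partial>cauchy_law \<gamma>) = 0" by (rule LIMSEQ_unique)
  then show "(\<integral>x. g (of_real x) \<partial>cauchy_law \<gamma>) = g \<gamma>"
    using int by (simp add: N.prob_space[simplified])
qed

text \<open>
  Fubini reduces this to the one-dimensional formula. The induction runs over the set \<open>J\<close> of variables
  that are still random while all others sit at \<open>\<gamma>\<close>: integrating out the variable \<open>i\<close> replaces it by
  \<open>\<gamma>\<close>. Measurability is required on the full product space because the functions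
  \<open>\<lambda>i. if i \<in> J then of_real (x i) else \<gamma>\<close> for the different \<open>J\<close> all have to be composed with \<open>F\<close>.
\<close>

theorem poisson_formula_PiM:
  fixes F :: "('i \<Rightarrow> complex) \<Rightarrow> complex"
  assumes \<gamma>: "Im \<gamma> > 0" and fin: "finite I"
    and cont: "\<And>z i. i \<in> I \<Longrightarrow> \<forall>j. Im (z j) \<ge> 0 \<Longrightarrow> continuous_on {w. Im w \<ge> 0} (\<lambda>w. F (z(i := w)))"
    and hol: "\<And>z i. i \<in> I \<Longrightarrow> \<forall>j. Im (z j) \<ge> 0 \<Longrightarrow> (\<lambda>w. F (z(i := w))) holomorphic_on {w. Im w > 0}"
    and bdd: "\<And>z. \<forall>j. Im (z j) \<ge> 0 \<Longrightarrow> cmod (F z) \<le> B"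
    and meas [measurable]: "F \<in> borel_measurable (PiM UNIV (\<lambda>_. borel))"
  shows "(\<integral>x. F (\<lambda>i. if i \<in> I then of_real (x i) else \<gamma>) \<partial>PiM I (\<lambda>_. cauchy_law \<gamma>)) = F (\<lambda>_. \<gamma>)"
  using fin subset_refl[of I]
proof (induction rule: finite_subset_induct')
  case empty
  then show ?case by (simp add: PiM_empty lebesgue_integral_count_space_finite)
next
  case (insert i J)
  interpret N: prob_space "cauchy_law \<gamma>" by (rule prob_space_cauchy_law[OF \<gamma>])
  interpret P: product_prob_space "\<lambda>_. cauchy_law \<gamma>" J by unfold_locales
  interpret P': prob_space "PiM K (\<lambda>_. cauchy_law \<gamma>)" for K :: "'i set"
    by (intro prob_space_PiM N.prob_space_axioms)
  define Z where "Z K x k = (if k \<in> K then complex_of_real (x k) else \<gamma>)" for K and x :: "'i \<Rightarrow> real" and k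
  have Z_Im: "\<forall>k. Im (Z K x k) \<ge> 0" for K x using \<gamma> by (simp add: Z_def)
  have "Z K \<in> PiM K (\<lambda>_. cauchy_law \<gamma>) \<rightarrow>\<^sub>M PiM UNIV (\<lambda>_. borel)" for K
    unfolding Z_def[abs_def]
  proof (intro measurable_PiM_single')
    fix k
    show "(\<lambda>x. if k \<in> K then complex_of_real (x k) else \<gamma>) \<in> borel_measurable (PiM K (\<lambda>_. cauchy_law \<gamma>))"
      by (cases "k \<in> K") simp_all
  qed auto
  from measurable_compose[OF this meas]
  have measZ [measurable]: "(\<lambda>x. F (Z K x)) \<in> borel_measurable (PiM K (\<lambda>_. cauchy_law \<gamma>))" for K .
  have "integrable (PiM (insert i J) (\<lambda>_. cauchy_law \<gamma>)) (\<lambda>x. F (Z (insert i J) x))"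
    by (intro P'.integrable_const_bound[where B = B]) (auto intro!: bdd Z_Im)
  then have "(\<integral>x. F (Z (insert i J) x) \<partial>PiM (insert i J) (\<lambda>_. cauchy_law \<gamma>)) =
      (\<integral>x. \<integral>y. F (Z (insert i J) (x(i := y))) \<partial>cauchy_law \<gamma> \<partial>PiM J (\<lambda>_. cauchy_law \<gamma>))"
    using insert.hyps by (intro P.product_integral_insert) auto
  also have "\<dots> = (\<integral>x. F (Z J x) \<partial>PiM J (\<lambda>_. cauchy_law \<gamma>))"
  proof (intro Bochner_Integration.integral_cong refl)
    fix x
    have "Z (insert i J) (x(i := y)) = (Z J x)(i := of_real y)" for y
      using insert.hyps by (auto simp: Z_def fun_eq_iff)
    then have "(\<integral>y. F (Z (insert i J) (x(i := y))) \<partial>cauchy_law \<gamma>) =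
        (\<integral>y. F ((Z J x)(i := of_real y)) \<partial>cauchy_law \<gamma>)" by simp
    also have "\<dots> = F ((Z J x)(i := \<gamma>))"
      using insert.hyps Z_Im
      by (intro poisson_formula(2)[where B = B] \<gamma> cont hol bdd) auto
    also have "(Z J x)(i := \<gamma>) = Z J x"
      using insert.hyps by (auto simp: Z_def fun_eq_iff)
    finally show "(\<integral>y. F (Z (insert i J) (x(i := y))) \<partial>cauchy_law \<gamma>) = F (Z J x)" .
  qed
  finally show ?case using insert.IH by (simp add: Z_def[abs_def])
qed

section \<open>Powers on the closed upper half-plane\<close>

lemma powr_real_polar:
  "z powr of_real p = of_real (cmod z powr p) * cis (p * Arg z)"
proof (cases "z = 0")
  case False
  then have "z powr of_real p = exp (of_real (p * ln (cmod z)) + \<i> * of_real (p * Arg z))"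
    unfolding powr_def by (subst Ln_Arg) (simp_all add: algebra_simps)
  also have "\<dots> = of_real (exp (p * ln (cmod z))) * cis (p * Arg z)"
    by (simp only: exp_add exp_of_real cis_conv_exp)
  finally show ?thesis using False by (simp add: powr_def)
qed simp

lemma Im_powr_upper_nonpos:
  assumes "Im z \<ge> 0" "-1 \<le> p" "p < 0"
  shows "Im (z powr of_real p) \<le> 0"
proof -
  have "0 \<le> Arg z" "Arg z \<le> pi" using assms Arg_less_0 Arg_le_pi by auto
  then have "0 \<le> (-p) * Arg z" "(-p) * Arg z \<le> 1 * pi"
    using assms by (intro mult_nonneg_nonneg mult_mono; simp)+
  then have "0 \<le> sin ((-p) * Arg z)" by (intro sin_ge_zero) auto
  then show ?thesis by (simp add: powr_real_polar mult_nonneg_nonpos)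
qed

text \<open>
  The argument of \<open>z\<^sup>p\<close> lies between \<open>0\<close> and \<open>p\<pi>\<close>, hence within \<open>|p|\<pi>/2\<close> of the bisector direction
  \<open>p\<pi>/2\<close>. Projecting onto the bisector therefore loses at most the factor \<open>cos (p\<pi>/2)\<close>, and
  sums of such powers cannot cancel when \<open>|p| < 1\<close>.
\<close>

lemma powr_upper_sector:
  assumes "Im z \<ge> 0" "\<bar>p\<bar> \<le> 1"
  shows "cos (p * pi / 2) * cmod z powr p \<le> Re (z powr of_real p * cnj (cis (p * pi / 2)))"
proof -
  have "0 \<le> Arg z" "Arg z \<le> pi" using assms Arg_less_0 Arg_le_pi by auto
  then have "\<bar>Arg z - pi/2\<bar> \<le> pi/2" by linarith
  then have "\<bar>p\<bar> * \<bar>Arg z - pi/2\<bar> \<le> \<bar>p\<bar> * (pi/2)" by (intro mult_left_mono) auto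
  then have le: "\<bar>p * (Arg z - pi/2)\<bar> \<le> \<bar>p * (pi/2)\<bar>" by (simp add: abs_mult)
  have "\<bar>p\<bar> * (pi/2) \<le> 1 * pi" using assms by (intro mult_mono) auto
  then have "cos \<bar>p * (pi/2)\<bar> \<le> cos \<bar>p * (Arg z - pi/2)\<bar>"
    using le by (intro cos_monotone_0_pi_le) (auto simp: abs_mult)
  then have "cos (p * pi / 2) \<le> cos (p * Arg z - p * pi / 2)"
    unfolding cos_abs_real by (simp add: right_diff_distrib)
  moreover have "Re (z powr of_real p * cnj (cis (p * pi / 2))) =
      cmod z powr p * cos (p * Arg z - p * pi / 2)"
    by (simp add: powr_real_polar cos_diff algebra_simps)
  ultimately show ?thesis by (simp add: mult.commute mult_left_mono)
qed

lemma cos_half_pi_nonneg: "\<bar>p\<bar> \<le> 1 \<Longrightarrow> cos (p * pi / 2) \<ge> 0" for p :: real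
  using mult_right_mono[of p 1 "pi/2"] mult_right_mono[of "-1" p "pi/2"]
  by (intro cos_ge_zero) auto

lemma cos_half_pi_pos: "\<bar>p\<bar> < 1 \<Longrightarrow> cos (p * pi / 2) > 0" for p :: real
  using mult_strict_right_mono[of p 1 "pi/2"] mult_strict_right_mono[of "-1" p "pi/2"]
  by (intro cos_gt_zero_pi) auto

text \<open>The principal logarithm is discontinuous at negative reals, but not from above: after rotation
  by \<open>-\<pi>/2\<close> the closed upper half-plane minus the origin becomes a subset of the right half-plane
  that avoids the branch cut.\<close>

lemma Ln_upper_rotate:
  assumes "Im z \<ge> 0" "z \<noteq> 0"
  shows "Ln z = Ln (- \<i> * z) + \<i> * of_real (pi / 2)"
proof (rule Ln_unique)
  have "\<bar>Im (Ln (- \<i> * z))\<bar> \<le> pi/2"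
    using assms by (subst Re_Ln_pos_le) auto
  moreover have "Im (Ln (- \<i> * z) + \<i> * of_real (pi / 2)) = Im (Ln (- \<i> * z)) + pi / 2"
    by simp
  ultimately show "-pi < Im (Ln (- \<i> * z) + \<i> * of_real (pi / 2))"
    "Im (Ln (- \<i> * z) + \<i> * of_real (pi / 2)) \<le> pi"
    using pi_gt_zero by linarith+
  have "exp (\<i> * of_real (pi / 2)) = \<i>"
    unfolding cis_conv_exp[symmetric] by simp
  then show "exp (Ln (- \<i> * z) + \<i> * of_real (pi / 2)) = z"
    using assms unfolding exp_add by (simp add: mult.assoc[symmetric]) (simp add: mult.commute mult.assoc[symmetric])
qed

lemma tendsto_powr_upper:
  assumes f: "(f \<longlongrightarrow> z) F" and z: "Im z \<ge> 0" "z \<noteq> 0"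
    and Im: "eventually (\<lambda>x. Im (f x) \<ge> 0) F"
  shows "((\<lambda>x. f x powr a) \<longlongrightarrow> z powr a) F"
proof -
  have eq: "w powr a = exp (a * (Ln (- \<i> * w) + \<i> * of_real (pi / 2)))" if "Im w \<ge> 0" "w \<noteq> 0" for w
    using that Ln_upper_rotate[OF that] by (simp add: powr_def)
  have "- \<i> * z \<notin> \<real>\<^sub>\<le>\<^sub>0"
    using z by (auto simp: complex_nonpos_Reals_iff complex_eq_iff)
  then have "((\<lambda>x. exp (a * (Ln (- \<i> * f x) + \<i> * of_real (pi / 2)))) \<longlongrightarrow> z powr a) F"
    unfolding eq[OF z] by (intro tendsto_intros f)
  moreover have "eventually (\<lambda>x. exp (a * (Ln (- \<i> * f x) + \<i> * of_real (pi / 2))) = f x powr a) F"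
    using Im tendsto_imp_eventually_ne[OF f z(2)] by eventually_elim (simp add: eq)
  ultimately show ?thesis by (rule Lim_transform_eventually)
qed

lemma powr_powr_inverse_upper:
  assumes "Im z > 0" "-1 \<le> p" "p < 0"
  shows "(z powr of_real p) powr of_real (1 / p) = z"
proof -
  have z: "z \<noteq> 0" using assms by auto
  have "0 < Im (Ln z)" "Im (Ln z) < pi" using assms Im_Ln_pos_lt_imp by auto
  then have "p * Im (Ln z) < 0" "(-p) * Im (Ln z) \<le> 1 * Im (Ln z)"
    using assms by (intro mult_neg_pos mult_right_mono; simp)+
  then have "Ln (exp (of_real p * Ln z)) = of_real p * Ln z"
    using \<open>Im (Ln z) < pi\<close> by (intro Ln_exp) auto
  then show ?thesis using z assms by (simp add: powr_def)
qed

lemma powr_minus_one_complex: "w powr (-1) = inverse w" for w :: complex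
  using powr_minus[of w 1] by (cases "w = 0") auto

text \<open>Adding \<open>\<delta>u\<close> to a point \<open>w\<close> of the half-plane \<open>Re (w * cnj u) \<ge> 0\<close> moves it away from the origin:
  multiplied by \<open>cnj u\<close>, the step is the positive real \<open>\<delta>\<close> added to a number with nonnegative real
  part.\<close>

lemma
  assumes w: "Re (w * cnj (cis (p * pi / 2))) \<ge> 0" and \<delta>: "\<delta> > 0"
  shows norm_push_ge: "\<delta> \<le> cmod (w + of_real \<delta> * cis (p * pi / 2))"
    and norm_le_push: "cmod w \<le> cmod (w + of_real \<delta> * cis (p * pi / 2))"
proof -
  let ?u = "cis (p * pi / 2)"
  have "(w + of_real \<delta> * ?u) * cnj ?u = w * cnj ?u + of_real \<delta>"
    by (simp add: distrib_right cis_cnj mult.assoc cis_mult)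
  then have eq: "cmod (w + of_real \<delta> * ?u) = cmod (w * cnj ?u + of_real \<delta>)"
    by (metis complex_mod_cnj mult.right_neutral norm_cis norm_mult)
  show "\<delta> \<le> cmod (w + of_real \<delta> * ?u)"
    using w complex_Re_le_cmod[of "w * cnj ?u + of_real \<delta>"] unfolding eq by simp
  have "cmod v \<le> cmod (v + of_real \<delta>)" if "Re v \<ge> 0" for v
    using that \<delta> unfolding cmod_def
    by (auto intro!: real_sqrt_le_mono power_mono)
  from this[OF w] have "cmod (w * cnj ?u) \<le> cmod (w * cnj ?u + of_real \<delta>)" .
  then show "cmod w \<le> cmod (w + of_real \<delta> * ?u)"
    unfolding eq by (simp add: norm_mult)
qed

text \<open>With the imaginary part strictly negative, the shifted point stays off the branch cut of the
  outer power even for \<open>p = -1\<close>, where the sector itself contains the negative reals.\<close>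

lemma Im_push_neg:
  assumes "-1 \<le> p" "p < 0" "Im w \<le> 0" "\<delta> > 0"
  shows "Im (w + of_real \<delta> * cis (p * pi / 2)) < 0"
proof -
  have "(-p) * pi \<le> 1 * pi" using assms by (intro mult_right_mono) auto
  then have "0 < sin (- (p * pi / 2))"
    using assms pi_gt_zero mult_neg_pos[of p pi] by (intro sin_gt_zero) linarith+
  then have "\<delta> * sin (p * pi / 2) < 0" using assms by (simp add: mult_pos_neg)
  then show ?thesis using assms by simp
qed

section \<open>Expectations of regularised power means\<close>

definition power_average :: "real \<Rightarrow> complex \<Rightarrow> nat \<Rightarrow> (nat \<Rightarrow> complex) \<Rightarrow> complex" where
  "power_average p \<alpha> n z = 1 / of_nat n * (\<Sum>j=1..n. (z j + \<alpha>) powr of_real p)"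

abbreviation cauchy_product :: "complex \<Rightarrow> nat \<Rightarrow> (nat \<Rightarrow> real) measure" where
  "cauchy_product \<gamma> n \<equiv> PiM {1..n} (\<lambda>_. cauchy_law \<gamma>)"

lemma prob_space_cauchy_product: "Im \<gamma> > 0 \<Longrightarrow> prob_space (cauchy_product \<gamma> n)"
  by (intro prob_space_PiM prob_space_cauchy_law)

lemma power_average_const: "n \<ge> 1 \<Longrightarrow> power_average p \<alpha> n (\<lambda>_. z) = (z + \<alpha>) powr of_real p"
  by (simp add: power_average_def)

lemma power_average_cong: "(\<And>j. j \<in> {1..n} \<Longrightarrow> z j = z' j) \<Longrightarrow> power_average p \<alpha> n z = power_average p \<alpha> n z'"
  by (simp add: power_average_def)

lemma Im_power_average_nonpos:
  assumes "-1 \<le> p" "p < 0" "\<And>j. j \<in> {1..n} \<Longrightarrow> Im (z j + \<alpha>) \<ge> 0"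
  shows "Im (power_average p \<alpha> n z) \<le> 0"
proof -
  have "(\<Sum>j=1..n. Im ((z j + \<alpha>) powr of_real p)) \<le> 0"
    using assms by (intro sum_nonpos Im_powr_upper_nonpos) auto
  then have "(1 / real n) * (\<Sum>j=1..n. Im ((z j + \<alpha>) powr of_real p)) \<le> 0"
    by (intro mult_nonneg_nonpos) auto
  moreover have "power_average p \<alpha> n z = of_real (1 / real n) * (\<Sum>j=1..n. (z j + \<alpha>) powr of_real p)"
    by (simp add: power_average_def)
  ultimately show ?thesis by (simp only: Im_complex_of_real Re_complex_of_real times_complex.sel Im_sum)
qed

lemma power_average_sector:
  assumes "-1 \<le> p" "p < 0" "\<And>j. j \<in> {1..n} \<Longrightarrow> Im (z j + \<alpha>) \<ge> 0"
  shows "cos (p * pi / 2) / n * (\<Sum>j=1..n. cmod (z j + \<alpha>) powr p)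
    \<le> Re (power_average p \<alpha> n z * cnj (cis (p * pi / 2)))"
proof -
  have "(\<Sum>j=1..n. cos (p * pi / 2) * cmod (z j + \<alpha>) powr p)
      \<le> (\<Sum>j=1..n. Re ((z j + \<alpha>) powr of_real p * cnj (cis (p * pi / 2))))"
    using assms by (intro sum_mono powr_upper_sector) auto
  then have "1 / n * (\<Sum>j=1..n. cos (p * pi / 2) * cmod (z j + \<alpha>) powr p)
      \<le> 1 / n * (\<Sum>j=1..n. Re ((z j + \<alpha>) powr of_real p * cnj (cis (p * pi / 2))))"
    by (intro mult_left_mono) auto
  also have "\<dots> = Re (of_real (1 / real n) * (\<Sum>j=1..n. (z j + \<alpha>) powr of_real p * cnj (cis (p * pi / 2))))"
    by (simp only: Im_complex_of_real Re_complex_of_real times_complex.sel Re_sum)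
  also have "\<dots> = Re (power_average p \<alpha> n z * cnj (cis (p * pi / 2)))"
    by (simp add: power_average_def sum_distrib_right)
  finally show ?thesis by (simp add: sum_distrib_left)
qed

lemma power_average_sector_nonneg:
  assumes "-1 \<le> p" "p < 0" "\<And>j. j \<in> {1..n} \<Longrightarrow> Im (z j + \<alpha>) \<ge> 0"
  shows "Re (power_average p \<alpha> n z * cnj (cis (p * pi / 2))) \<ge> 0"
proof -
  have "0 \<le> cos (p * pi / 2) / n * (\<Sum>j=1..n. cmod (z j + \<alpha>) powr p)"
    using assms by (intro mult_nonneg_nonneg divide_nonneg_nonneg sum_nonneg cos_half_pi_nonneg) auto
  also note power_average_sector[OF assms]
  finally show ?thesis by simp
qed

text \<open>For \<open>p > -1\<close> the bisector \<open>u\<close> makes an angle less than \<open>\<pi>/2\<close> with the positive real axis, so a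
  nonpositive real has nonpositive component along \<open>u\<close>, whereas the average has positive component.\<close>

lemma power_average_not_nonpos:
  assumes p: "-1 < p" "p < 0" and n: "n \<ge> 1"
    and z: "\<And>j. j \<in> {1..n} \<Longrightarrow> Im (z j + \<alpha>) \<ge> 0 \<and> z j + \<alpha> \<noteq> 0"
  shows "power_average p \<alpha> n z \<notin> \<real>\<^sub>\<le>\<^sub>0"
proof
  assume "power_average p \<alpha> n z \<in> \<real>\<^sub>\<le>\<^sub>0"
  then obtain t where t: "t \<le> 0" "power_average p \<alpha> n z = of_real t"
    by (auto elim: nonpos_Reals_cases)
  have cos: "cos (p * pi / 2) > 0" using p by (intro cos_half_pi_pos) auto
  have "0 < (\<Sum>j=1..n. cmod (z j + \<alpha>) powr p)"
    using n z by (intro sum_pos) auto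
  then have "0 < cos (p * pi / 2) / n * (\<Sum>j=1..n. cmod (z j + \<alpha>) powr p)"
    using cos n by (intro mult_pos_pos divide_pos_pos) auto
  also have "\<dots> \<le> Re (power_average p \<alpha> n z * cnj (cis (p * pi / 2)))"
    using p z by (intro power_average_sector) auto
  also have "\<dots> = t * cos (p * pi / 2)" by (simp add: t)
  also have "\<dots> \<le> 0" using t cos by (intro mult_nonpos_nonneg) auto
  finally show False by simp
qed

text \<open>The power mean with its base shifted by \<open>\<delta>\<close> along the bisector of the sector of values of
  \<open>z\<^sup>p\<close>; at \<open>\<delta> = 0\<close> it is the power mean before the final subtraction of \<open>\<alpha>\<close>.\<close>

definition regularised_mean :: "real \<Rightarrow> complex \<Rightarrow> nat \<Rightarrow> real \<Rightarrow> (nat \<Rightarrow> complex) \<Rightarrow> complex" where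
  "regularised_mean p \<alpha> n \<delta> z =
     (power_average p \<alpha> n z + of_real \<delta> * cis (p * pi / 2)) powr of_real (1 / p)"

lemma borel_measurable_power_average [measurable]:
  assumes "\<And>j. j \<in> {1..n} \<Longrightarrow> (\<lambda>x. z x j) \<in> borel_measurable M"
  shows "(\<lambda>x. power_average p \<alpha> n (z x)) \<in> borel_measurable M"
  unfolding power_average_def using assms
  by (intro borel_measurable_times borel_measurable_sum borel_measurable_powr_complex
      borel_measurable_add borel_measurable_const) auto

lemma borel_measurable_regularised_mean [measurable]:
  assumes "\<And>j. j \<in> {1..n} \<Longrightarrow> (\<lambda>x. z x j) \<in> borel_measurable M"
  shows "(\<lambda>x. regularised_mean p \<alpha> n \<delta> (z x)) \<in> borel_measurable M"
  unfolding regularised_mean_def using assms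
  by (intro borel_measurable_powr_complex borel_measurable_add borel_measurable_power_average
      borel_measurable_const) auto

lemma measurable_of_real_component [measurable]:
  "j \<in> {1..n} \<Longrightarrow> (\<lambda>x. complex_of_real (x j)) \<in> borel_measurable (cauchy_product \<gamma> n)"
  by measurable

text \<open>As \<open>1/p\<close> is negative, the lower bounds for the shifted base turn into upper bounds: a constant,
  which makes the Poisson formula applicable, and the power mean, which serves as a dominating
  function that does not depend on \<open>\<delta>\<close>.\<close>

lemma
  assumes "-1 \<le> p" "p < 0" "\<delta> > 0" "\<And>j. j \<in> {1..n} \<Longrightarrow> Im (z j + \<alpha>) \<ge> 0"
  shows norm_regularised_mean_le: "cmod (regularised_mean p \<alpha> n \<delta> z) \<le> \<delta> powr (1 / p)"
    and norm_regularised_mean_le_mean: "power_average p \<alpha> n z \<noteq> 0 \<Longrightarrow>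
      cmod (regularised_mean p \<alpha> n \<delta> z) \<le> cmod (power_average p \<alpha> n z powr of_real (1 / p))"
    and regularised_mean_base_slit:
      "power_average p \<alpha> n z + of_real \<delta> * cis (p * pi / 2) \<notin> \<real>\<^sub>\<le>\<^sub>0"
proof -
  note nonneg = power_average_sector_nonneg[OF assms(1,2,4)]
  show "cmod (regularised_mean p \<alpha> n \<delta> z) \<le> \<delta> powr (1 / p)"
    unfolding regularised_mean_def norm_powr_real_powr'[OF Reals_of_real] Re_complex_of_real
    using assms by (intro powr_mono2' norm_push_ge nonneg) auto
  show "cmod (regularised_mean p \<alpha> n \<delta> z) \<le> cmod (power_average p \<alpha> n z powr of_real (1 / p))"
    if "power_average p \<alpha> n z \<noteq> 0"
    unfolding regularised_mean_def norm_powr_real_powr'[OF Reals_of_real] Re_complex_of_real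
    using assms that by (intro powr_mono2' norm_le_push nonneg) auto
  show "power_average p \<alpha> n z + of_real \<delta> * cis (p * pi / 2) \<notin> \<real>\<^sub>\<le>\<^sub>0"
  proof -
    have "Im (power_average p \<alpha> n z) \<le> 0" by (rule Im_power_average_nonpos[OF assms(1,2,4)])
    from Im_push_neg[OF assms(1,2) this assms(3)] show ?thesis
      by (simp add: complex_nonpos_Reals_iff)
  qed
qed

lemma holomorphic_on_regularised_mean:
  assumes p: "-1 \<le> p" "p < 0" and \<delta>: "\<delta> > 0" and \<alpha>: "Im \<alpha> > 0" and z: "\<forall>j. Im (z j) \<ge> 0"
  shows "(\<lambda>w. regularised_mean p \<alpha> n \<delta> (z(i := w))) holomorphic_on {w. Im w > - Im \<alpha>}"
proof -
  have 1: "(\<lambda>w. (z(i := w)) j + \<alpha>) holomorphic_on {w. Im w > - Im \<alpha>}" for j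
    by (cases "j = i") (auto intro!: holomorphic_intros)
  have 2: "Im ((z(i := w)) j + \<alpha>) > 0" if "Im w > - Im \<alpha>" for w j
    using that \<alpha> z[rule_format, of j] by auto
  have 3: "(\<lambda>w. ((z(i := w)) j + \<alpha>) powr of_real p) holomorphic_on {w. Im w > - Im \<alpha>}" for j
    using 2[of _ j] by (intro holomorphic_on_powr 1) (fastforce simp: complex_nonpos_Reals_iff)+
  have slit: "power_average p \<alpha> n (z(i := w)) + of_real \<delta> * cis (p * pi / 2) \<notin> \<real>\<^sub>\<le>\<^sub>0"
    if "Im w > - Im \<alpha>" for w
    using 2[OF that] by (intro regularised_mean_base_slit p \<delta>) (auto simp: less_imp_le)
  have "(\<lambda>w. power_average p \<alpha> n (z(i := w)) + of_real \<delta> * cis (p * pi / 2))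
      holomorphic_on {w. Im w > - Im \<alpha>}"
    unfolding power_average_def
    by (intro holomorphic_on_add holomorphic_on_mult holomorphic_on_sum holomorphic_on_const 3)
  then show ?thesis
    unfolding regularised_mean_def
    by (intro holomorphic_on_powr holomorphic_on_const) (simp_all add: slit)
qed

lemma expectation_regularised_mean_interior:
  assumes \<gamma>: "Im \<gamma> > 0" and p: "-1 \<le> p" "p < 0" and \<delta>: "\<delta> > 0" and \<alpha>: "Im \<alpha> > 0"
  shows "(\<integral>x. regularised_mean p \<alpha> n \<delta> (\<lambda>j. of_real (x j)) \<partial>cauchy_product \<gamma> n) =
    regularised_mean p \<alpha> n \<delta> (\<lambda>_. \<gamma>)"
proof -
  have "(\<integral>x. regularised_mean p \<alpha> n \<delta> (\<lambda>j. of_real (x j)) \<partial>cauchy_product \<gamma> n) =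
      (\<integral>x. regularised_mean p \<alpha> n \<delta> (\<lambda>j. if j \<in> {1..n} then of_real (x j) else \<gamma>) \<partial>cauchy_product \<gamma> n)"
    by (auto simp: regularised_mean_def intro!: Bochner_Integration.integral_cong
        arg_cong2[where f = "(powr)"] power_average_cong)
  also have "\<dots> = regularised_mean p \<alpha> n \<delta> (\<lambda>_. \<gamma>)"
  proof (rule poisson_formula_PiM[where B = "\<delta> powr (1 / p)"])
    fix z :: "nat \<Rightarrow> complex" and i assume z: "\<forall>j. Im (z j) \<ge> 0"
    note hol = holomorphic_on_regularised_mean[OF p \<delta> \<alpha> z, of n i]
    show "(\<lambda>w. regularised_mean p \<alpha> n \<delta> (z(i := w))) holomorphic_on {w. Im w > 0}"
      using \<alpha> by (intro holomorphic_on_subset[OF hol]) auto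
    show "continuous_on {w. Im w \<ge> 0} (\<lambda>w. regularised_mean p \<alpha> n \<delta> (z(i := w)))"
      using \<alpha> by (intro holomorphic_on_imp_continuous_on holomorphic_on_subset[OF hol]) auto
    show "cmod (regularised_mean p \<alpha> n \<delta> z) \<le> \<delta> powr (1 / p)"
      using z \<alpha> by (intro norm_regularised_mean_le p \<delta>) (auto simp: add_nonneg_nonneg less_imp_le)
  qed (use \<gamma> in auto)
  finally show ?thesis .
qed

lemma AE_cauchy_product_nonzero:
  assumes "Im \<gamma> > 0"
  shows "AE x in cauchy_product \<gamma> n. \<forall>j\<in>{1..n}. complex_of_real (x j) + \<alpha> \<noteq> 0"
proof -
  have "AE x in cauchy_product \<gamma> n. x j \<noteq> - Re \<alpha>" if "j \<in> {1..n}" for j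
    using that assms by (intro AE_PiM_component AE_cauchy_law_neq prob_space_cauchy_law) auto
  then have "AE x in cauchy_product \<gamma> n. \<forall>j\<in>{1..n}. x j \<noteq> - Re \<alpha>"
    by (intro AE_finite_allI) auto
  then show ?thesis
    by eventually_elim (auto simp: complex_eq_iff add_eq_0_iff)
qed

text \<open>Each \<open>z\<^sub>j + \<alpha>\<close> may be a negative real; there the inner power is continuous only from above, and
  this is the direction from which the shifted parameters approach.\<close>

lemma tendsto_regularised_mean_shift:
  assumes p: "-1 \<le> p" "p < 0" and \<delta>: "\<delta> > 0"
    and z: "\<And>j. j \<in> {1..n} \<Longrightarrow> Im (z j + \<alpha>) \<ge> 0 \<and> z j + \<alpha> \<noteq> 0"
  shows "(\<lambda>k. regularised_mean p (\<alpha> + \<i> * of_real (inverse (real (Suc k)))) n \<delta> z)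
    \<longlonglongrightarrow> regularised_mean p \<alpha> n \<delta> z"
proof -
  have lim: "(\<lambda>k. z j + (\<alpha> + \<i> * of_real (inverse (real (Suc k))))) \<longlonglongrightarrow> z j + (\<alpha> + \<i> * of_real 0)" for j
    by (intro tendsto_intros LIMSEQ_inverse_real_of_nat)
  have summand: "(\<lambda>k. (z j + (\<alpha> + \<i> * of_real (inverse (real (Suc k))))) powr of_real p)
      \<longlonglongrightarrow> (z j + \<alpha>) powr of_real p" if "j \<in> {1..n}" for j
  proof (rule tendsto_powr_upper)
    show "(\<lambda>k. z j + (\<alpha> + \<i> * of_real (inverse (real (Suc k))))) \<longlonglongrightarrow> z j + \<alpha>"
      using lim[of j] by simp
    show "\<forall>\<^sub>F k in sequentially. 0 \<le> Im (z j + (\<alpha> + \<i> * of_real (inverse (real (Suc k)))))"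
    proof (rule always_eventually, rule allI)
      fix k
      have "0 \<le> Im (z j + \<alpha>) + inverse (real (Suc k))"
        using z[OF that] by (intro add_nonneg_nonneg) auto
      also have "\<dots> = Im (z j + (\<alpha> + \<i> * of_real (inverse (real (Suc k)))))"
        by (simp del: of_real_inverse)
      finally show "0 \<le> Im (z j + (\<alpha> + \<i> * of_real (inverse (real (Suc k)))))" .
    qed
  qed (use z[OF that] in auto)
  have "(\<lambda>k. power_average p (\<alpha> + \<i> * of_real (inverse (real (Suc k)))) n z + of_real \<delta> * cis (p * pi / 2))
      \<longlonglongrightarrow> power_average p \<alpha> n z + of_real \<delta> * cis (p * pi / 2)"
    unfolding power_average_def by (intro tendsto_add tendsto_mult tendsto_sum tendsto_const summand)
  moreover have "power_average p \<alpha> n z + of_real \<delta> * cis (p * pi / 2) \<notin> \<real>\<^sub>\<le>\<^sub>0"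
    using z by (intro regularised_mean_base_slit p \<delta>) auto
  ultimately show ?thesis
    unfolding regularised_mean_def by (intro tendsto_powr_complex tendsto_const)
qed

text \<open>For \<open>\<alpha>\<close> in the interior this is the Poisson formula; for \<open>\<alpha>\<close> on the real line, the mean is
  discontinuous where some \<open>x\<^sub>j + \<alpha>\<close> vanishes, a null set, and the identity follows by approaching
  \<open>\<alpha>\<close> from above.\<close>

lemma expectation_regularised_mean:
  assumes \<gamma>: "Im \<gamma> > 0" and p: "-1 \<le> p" "p < 0" and \<delta>: "\<delta> > 0" and \<alpha>: "Im \<alpha> \<ge> 0"
  shows "(\<integral>x. regularised_mean p \<alpha> n \<delta> (\<lambda>j. of_real (x j)) \<partial>cauchy_product \<gamma> n) =
    regularised_mean p \<alpha> n \<delta> (\<lambda>_. \<gamma>)"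
proof (rule LIMSEQ_unique)
  interpret prob_space "cauchy_product \<gamma> n" by (rule prob_space_cauchy_product[OF \<gamma>])
  let ?\<alpha> = "\<lambda>k. \<alpha> + \<i> * of_real (inverse (real (Suc k)))"
  have Im_\<alpha>: "Im (?\<alpha> k) = Im \<alpha> + inverse (real (Suc k))" for k
    by (simp del: of_real_inverse)
  have \<alpha>_pos: "Im (?\<alpha> k) > 0" for k
    unfolding Im_\<alpha> using \<alpha> by (intro add_nonneg_pos) auto
  show "(\<lambda>k. \<integral>x. regularised_mean p (?\<alpha> k) n \<delta> (\<lambda>j. of_real (x j)) \<partial>cauchy_product \<gamma> n)
      \<longlonglongrightarrow> (\<integral>x. regularised_mean p \<alpha> n \<delta> (\<lambda>j. of_real (x j)) \<partial>cauchy_product \<gamma> n)"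
  proof (rule integral_dominated_convergence[where w = "\<lambda>_. \<delta> powr (1 / p)"])
    show "AE x in cauchy_product \<gamma> n. (\<lambda>k. regularised_mean p (?\<alpha> k) n \<delta> (\<lambda>j. of_real (x j)))
        \<longlonglongrightarrow> regularised_mean p \<alpha> n \<delta> (\<lambda>j. of_real (x j))"
      using AE_cauchy_product_nonzero[OF \<gamma>, of n \<alpha>]
      by eventually_elim (use \<alpha> in \<open>intro tendsto_regularised_mean_shift p \<delta>; auto\<close>)
    show "AE x in cauchy_product \<gamma> n. cmod (regularised_mean p (?\<alpha> k) n \<delta> (\<lambda>j. of_real (x j)))
        \<le> \<delta> powr (1 / p)" for k
      using less_imp_le[OF \<alpha>_pos] by (intro AE_I2 norm_regularised_mean_le p \<delta>) simp
    show "integrable (cauchy_product \<gamma> n) (\<lambda>_. \<delta> powr (1 / p))" by (rule integrable_const)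
  qed (simp_all del: of_real_inverse)
  show "(\<lambda>k. \<integral>x. regularised_mean p (?\<alpha> k) n \<delta> (\<lambda>j. of_real (x j)) \<partial>cauchy_product \<gamma> n)
      \<longlonglongrightarrow> regularised_mean p \<alpha> n \<delta> (\<lambda>_. \<gamma>)"
  proof -
    have "(\<integral>x. regularised_mean p (?\<alpha> k) n \<delta> (\<lambda>j. of_real (x j)) \<partial>cauchy_product \<gamma> n) =
        regularised_mean p (?\<alpha> k) n \<delta> (\<lambda>_. \<gamma>)" for k
      by (intro expectation_regularised_mean_interior \<gamma> p \<delta> \<alpha>_pos)
    moreover have "Im (\<gamma> + \<alpha>) > 0" using \<alpha> \<gamma> by simp
    then have "Im (\<gamma> + \<alpha>) \<ge> 0 \<and> \<gamma> + \<alpha> \<noteq> 0"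
      by (metis less_eq_real_def less_irrefl zero_complex.sel(2))
    then have "(\<lambda>k. regularised_mean p (?\<alpha> k) n \<delta> (\<lambda>_. \<gamma>)) \<longlonglongrightarrow> regularised_mean p \<alpha> n \<delta> (\<lambda>_. \<gamma>)"
      by (intro tendsto_regularised_mean_shift p \<delta>)
    ultimately show ?thesis by (simp only:)
  qed
qed

text \<open>
  Let \<open>\<delta>\<close> tend to 0; the power mean itself is the dominating function. The second part of the last
  hypothesis keeps the base off the branch cut of the outer power, where the limit could fail; for
  \<open>p = -1\<close> that power is the inverse, which has no cut.
\<close>

lemma expectation_power_mean:
  assumes \<gamma>: "Im \<gamma> > 0" and p: "-1 \<le> p" "p < 0" and \<alpha>: "Im \<alpha> \<ge> 0" and n: "n \<ge> 1"
    and int: "integrable (cauchy_product \<gamma> n) (\<lambda>x. power_average p \<alpha> n (\<lambda>j. of_real (x j)) powr of_real (1 / p))"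
    and ne: "AE x in cauchy_product \<gamma> n. power_average p \<alpha> n (\<lambda>j. of_real (x j)) \<noteq> 0 \<and>
      (p = -1 \<or> power_average p \<alpha> n (\<lambda>j. of_real (x j)) \<notin> \<real>\<^sub>\<le>\<^sub>0)"
  shows "(\<integral>x. power_average p \<alpha> n (\<lambda>j. of_real (x j)) powr of_real (1 / p) \<partial>cauchy_product \<gamma> n) = \<gamma> + \<alpha>"
proof (rule LIMSEQ_unique)
  let ?\<delta> = "\<lambda>k. inverse (real (Suc k))"
  have \<delta>: "?\<delta> k > 0" for k by simp
  have lim: "(\<lambda>k. regularised_mean p \<alpha> n (?\<delta> k) z) \<longlonglongrightarrow> power_average p \<alpha> n z powr of_real (1 / p)"
    if z: "power_average p \<alpha> n z \<noteq> 0" "p = -1 \<or> power_average p \<alpha> n z \<notin> \<real>\<^sub>\<le>\<^sub>0" for z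
  proof -
    have base: "(\<lambda>k. power_average p \<alpha> n z + of_real (?\<delta> k) * cis (p * pi / 2)) \<longlonglongrightarrow>
        power_average p \<alpha> n z + of_real 0 * cis (p * pi / 2)"
      by (intro tendsto_intros LIMSEQ_inverse_real_of_nat)
    show ?thesis
    proof (cases "p = -1")
      case True
      then show ?thesis
        using tendsto_inverse[OF base] z
        by (simp add: regularised_mean_def powr_minus_one_complex)
    next
      case False
      then show ?thesis
        using base z unfolding regularised_mean_def
        by (intro tendsto_powr_complex tendsto_const) auto
    qed
  qed
  show "(\<lambda>k. \<integral>x. regularised_mean p \<alpha> n (?\<delta> k) (\<lambda>j. of_real (x j)) \<partial>cauchy_product \<gamma> n) \<longlonglongrightarrow>
      (\<integral>x. power_average p \<alpha> n (\<lambda>j. of_real (x j)) powr of_real (1 / p) \<partial>cauchy_product \<gamma> n)"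
  proof (rule integral_dominated_convergence[where
        w = "\<lambda>x. cmod (power_average p \<alpha> n (\<lambda>j. of_real (x j)) powr of_real (1 / p))"])
    show "AE x in cauchy_product \<gamma> n. (\<lambda>k. regularised_mean p \<alpha> n (?\<delta> k) (\<lambda>j. of_real (x j)))
        \<longlonglongrightarrow> power_average p \<alpha> n (\<lambda>j. of_real (x j)) powr of_real (1 / p)"
      using ne by eventually_elim (intro lim; simp)
    show "AE x in cauchy_product \<gamma> n. cmod (regularised_mean p \<alpha> n (?\<delta> k) (\<lambda>j. of_real (x j)))
        \<le> cmod (power_average p \<alpha> n (\<lambda>j. of_real (x j)) powr of_real (1 / p))" for k
      using ne by eventually_elim (use \<alpha> in \<open>intro norm_regularised_mean_le_mean p \<delta>; simp\<close>)
    show "integrable (cauchy_product \<gamma> n)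
        (\<lambda>x. cmod (power_average p \<alpha> n (\<lambda>j. of_real (x j)) powr of_real (1 / p)))"
      by (rule integrable_norm[OF int])
  qed (auto intro: borel_measurable_integrable int)
  have "Im (\<gamma> + \<alpha>) > 0" using \<alpha> \<gamma> by simp
  then have root: "((\<gamma> + \<alpha>) powr of_real p) powr of_real (1 / p) = \<gamma> + \<alpha>"
    by (intro powr_powr_inverse_upper p)
  have "\<gamma> + \<alpha> \<noteq> 0" using \<open>Im (\<gamma> + \<alpha>) > 0\<close> by (metis less_irrefl zero_complex.sel(2))
  moreover have "p = -1 \<or> (\<gamma> + \<alpha>) powr of_real p \<notin> \<real>\<^sub>\<le>\<^sub>0"
    using power_average_not_nonpos[of p 1 "\<lambda>_. \<gamma>" \<alpha>] p \<open>Im (\<gamma> + \<alpha>) > 0\<close> \<open>\<gamma> + \<alpha> \<noteq> 0\<close>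
    by (auto simp: power_average_const)
  ultimately have "(\<lambda>k. regularised_mean p \<alpha> n (?\<delta> k) (\<lambda>_. \<gamma>)) \<longlonglongrightarrow> \<gamma> + \<alpha>"
    using lim[of "\<lambda>_. \<gamma>"] unfolding power_average_const[OF n] root by simp
  then show "(\<lambda>k. \<integral>x. regularised_mean p \<alpha> n (?\<delta> k) (\<lambda>j. of_real (x j)) \<partial>cauchy_product \<gamma> n) \<longlonglongrightarrow> \<gamma> + \<alpha>"
    using expectation_regularised_mean[OF \<gamma> p \<delta> \<alpha>] by simp
qed

section \<open>Fractional moments\<close>

text \<open>
  Kolmogorov's inequality for functions with values in the upper half-plane: \<open>h\<^sup>q\<close> lies in a sector of
  opening \<open>q\<pi> < \<pi>\<close>, so \<open>|h|\<^sup>q\<close> is comparable to the component of \<open>h\<^sup>q\<close> along the bisector, and the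
  expectation of that component is its value at \<open>\<gamma>\<close>.
\<close>

lemma fractional_moment_bound:
  assumes \<gamma>: "Im \<gamma> > 0" and q: "0 < q" "q < 1"
    and cont: "continuous_on {z. Im z \<ge> 0} h"
    and hol: "h holomorphic_on {z. Im z > 0}"
    and Im_h: "\<And>z. Im z \<ge> 0 \<Longrightarrow> Im (h z) > 0"
    and bdd: "\<And>z. Im z \<ge> 0 \<Longrightarrow> cmod (h z) \<le> B"
  shows "(\<integral>\<^sup>+x. ennreal (cmod (h (of_real x)) powr q) \<partial>cauchy_law \<gamma>)
    \<le> ennreal (cmod (h \<gamma>) powr q / cos (q * pi / 2))"
proof -
  let ?g = "\<lambda>z. h z powr of_real q" and ?u = "cnj (cis (q * pi / 2))"
  have cos: "cos (q * pi / 2) > 0" using q by (intro cos_half_pi_pos) auto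
  have slit: "h z \<notin> \<real>\<^sub>\<le>\<^sub>0" if "Im z \<ge> 0" for z
    using Im_h[OF that] by (simp add: complex_nonpos_Reals_iff)
  have "continuous_on {z. Im z \<ge> 0} ?g"
    using slit q by (intro continuous_intros cont) (auto simp: complex_nonpos_Reals_iff)
  moreover have "?g holomorphic_on {z. Im z > 0}"
    using slit by (intro holomorphic_intros hol) auto
  moreover have "cmod (?g z) \<le> B powr q" if "Im z \<ge> 0" for z
    using bdd[OF that] q by (simp add: norm_powr_real_powr' powr_mono2)
  ultimately have poisson: "integrable (cauchy_law \<gamma>) (\<lambda>x. ?g (of_real x))"
    "(\<integral>x. ?g (of_real x) \<partial>cauchy_law \<gamma>) = ?g \<gamma>"
    using poisson_formula[OF \<gamma>, of ?g] by blast+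
  let ?f = "\<lambda>x. Re (?g (of_real x) * ?u) / cos (q * pi / 2)"
  have int: "integrable (cauchy_law \<gamma>) ?f"
    by (intro integrable_divide integrable_Re integrable_mult_left poisson(1))
  have le: "cmod (h (of_real x)) powr q \<le> ?f x" for x
    using powr_upper_sector[of "h (of_real x)" q] Im_h[of "of_real x"] q cos
    by (simp add: pos_le_divide_eq mult.commute)
  have "(\<integral>\<^sup>+x. ennreal (cmod (h (of_real x)) powr q) \<partial>cauchy_law \<gamma>) \<le> (\<integral>\<^sup>+x. ennreal (?f x) \<partial>cauchy_law \<gamma>)"
    by (intro nn_integral_mono ennreal_leI le)
  also have "\<dots> = ennreal (\<integral>x. ?f x \<partial>cauchy_law \<gamma>)"
    using le by (intro nn_integral_eq_integral int AE_I2) (rule order_trans[OF powr_ge_zero])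
  also have "(\<integral>x. ?f x \<partial>cauchy_law \<gamma>) = Re (\<integral>x. ?g (of_real x) * ?u \<partial>cauchy_law \<gamma>) / cos (q * pi / 2)"
    by (subst integral_Re[symmetric]) (auto intro!: integrable_mult_left poisson(1))
  also have "(\<integral>x. ?g (of_real x) * ?u \<partial>cauchy_law \<gamma>) = ?g \<gamma> * ?u"
    using poisson(2) by simp
  also have "ennreal (Re (?g \<gamma> * ?u) / cos (q * pi / 2)) \<le> ennreal (cmod (?g \<gamma> * ?u) / cos (q * pi / 2))"
    using cos by (intro ennreal_leI divide_right_mono complex_Re_le_cmod) auto
  also have "cmod (?g \<gamma> * ?u) = cmod (h \<gamma>) powr q"
    by (simp add: norm_mult norm_powr_real_powr')
  finally show ?thesis .
qed

lemma Im_inverse_neg: "Im w > 0 \<Longrightarrow> Im (inverse w) < 0"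
  by (cases "w = 0") (auto simp: divide_neg_pos sum_power2_gt_zero_iff complex_eq_iff)

lemma Im_inverse_pos: "Im w < 0 \<Longrightarrow> Im (inverse w) > 0"
  by (cases "w = 0") (auto simp: divide_neg_pos sum_power2_gt_zero_iff complex_eq_iff)

lemma norm_inverse_le_Im: "Im w \<le> - c \<Longrightarrow> 0 < c \<Longrightarrow> cmod (inverse w) \<le> inverse c"
  using abs_Im_le_cmod[of w] unfolding norm_inverse by (intro le_imp_inverse_le) auto

text \<open>The bound is uniform in \<open>s\<close> because \<open>s\<close> only pushes the denominator at \<open>\<gamma>\<close> further down into the
  lower half-plane, in which \<open>1/(\<gamma> + \<alpha>)\<close> already lies.\<close>

lemma fractional_moment_uniform:
  assumes \<gamma>: "Im \<gamma> > 0" and \<alpha>: "Im \<alpha> > 0" and q: "0 < q" "q < 1"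
  obtains C where "\<And>s. Im s < 0 \<Longrightarrow>
    (\<integral>\<^sup>+x. ennreal (cmod (inverse (s + inverse (of_real x + \<alpha>))) powr q) \<partial>cauchy_law \<gamma>) \<le> ennreal C"
proof
  define c where "c = - Im (inverse (\<gamma> + \<alpha>))"
  have c: "c > 0" using Im_inverse_neg[of "\<gamma> + \<alpha>"] \<gamma> \<alpha> by (simp add: c_def)
  have cos: "cos (q * pi / 2) > 0" using q by (intro cos_half_pi_pos) auto
  fix s assume s: "Im s < 0"
  let ?h = "\<lambda>z. inverse (s + inverse (z + \<alpha>))"
  have ne: "z + \<alpha> \<noteq> 0" if "Im z \<ge> 0" for z
    using that \<alpha> by (auto simp: complex_eq_iff)
  have Im: "Im (s + inverse (z + \<alpha>)) < Im s" if "Im z \<ge> 0" for z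
    using that \<alpha> Im_inverse_neg[of "z + \<alpha>"] by simp
  have ne': "s + inverse (z + \<alpha>) \<noteq> 0" if "Im z \<ge> 0" for z
    using Im[OF that] s by (metis not_less_iff_gr_or_eq order.strict_trans zero_complex.sel(2))
  have "(\<integral>\<^sup>+x. ennreal (cmod (?h (of_real x)) powr q) \<partial>cauchy_law \<gamma>)
      \<le> ennreal (cmod (?h \<gamma>) powr q / cos (q * pi / 2))"
  proof (rule fractional_moment_bound[OF \<gamma> q])
    show "continuous_on {z. Im z \<ge> 0} ?h"
      using ne ne' by (intro continuous_intros) auto
    show "?h holomorphic_on {z. Im z > 0}"
      using ne ne' by (intro holomorphic_intros) (auto simp: less_imp_le)
    show "Im (?h z) > 0" if "Im z \<ge> 0" for z
      using Im[OF that] s by (intro Im_inverse_pos) simp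
    show "cmod (?h z) \<le> inverse (- Im s)" if "Im z \<ge> 0" for z
      using Im[OF that] s by (intro norm_inverse_le_Im) auto
  qed
  also have "cmod (?h \<gamma>) \<le> inverse c"
    using s c by (intro norm_inverse_le_Im) (simp_all add: c_def)
  then have "cmod (?h \<gamma>) powr q / cos (q * pi / 2) \<le> inverse c powr q / cos (q * pi / 2)"
    using q cos by (intro divide_right_mono powr_mono2) auto
  finally show "(\<integral>\<^sup>+x. ennreal (cmod (?h (of_real x)) powr q) \<partial>cauchy_law \<gamma>)
      \<le> ennreal (inverse c powr q / cos (q * pi / 2))"
    by (auto intro: ennreal_leI order_trans)
qed

text \<open>As \<open>s\<close> tends to 0, \<open>1/(s + 1/(x + \<alpha>))\<close> tends to \<open>x + \<alpha>\<close>, so Fatou's lemma carries the uniform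
  bound over. The additional shift by \<open>\<i>\<close> brings \<open>\<alpha>\<close> into the open half-plane and only enlarges
  the modulus.\<close>

lemma half_moment_finite:
  assumes \<gamma>: "Im \<gamma> > 0" and \<alpha>: "Im \<alpha> \<ge> 0"
  shows "(\<integral>\<^sup>+x. ennreal (cmod (of_real x + \<alpha>) powr (1/2)) \<partial>cauchy_law \<gamma>) < \<infinity>"
proof -
  have \<alpha>': "Im (\<alpha> + \<i>) > 0" using \<alpha> by simp
  obtain C where C: "\<And>s. Im s < 0 \<Longrightarrow>
      (\<integral>\<^sup>+x. ennreal (cmod (inverse (s + inverse (of_real x + (\<alpha> + \<i>)))) powr (1/2)) \<partial>cauchy_law \<gamma>) \<le> ennreal C"
    using fractional_moment_uniform[OF \<gamma> \<alpha>', of "1/2"] by auto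
  define s where "s k = - \<i> * of_real (inverse (real (Suc k)))" for k
  have s: "Im (s k) < 0" for k by (simp add: s_def del: of_real_inverse)
  have s_lim: "s \<longlonglongrightarrow> - \<i> * of_real 0"
    unfolding s_def[abs_def] by (intro tendsto_intros LIMSEQ_inverse_real_of_nat)
  have lim: "(\<lambda>k. ennreal (cmod (inverse (s k + inverse (of_real x + (\<alpha> + \<i>)))) powr (1/2)))
      \<longlonglongrightarrow> ennreal (cmod (of_real x + (\<alpha> + \<i>)) powr (1/2))" for x
  proof -
    have ne: "of_real x + (\<alpha> + \<i>) \<noteq> 0" using \<alpha> by (auto simp: complex_eq_iff)
    have "(\<lambda>k. cmod (inverse (s k + inverse (of_real x + (\<alpha> + \<i>)))) powr (1/2))
      \<longlonglongrightarrow> cmod (inverse (- \<i> * of_real 0 + inverse (of_real x + (\<alpha> + \<i>)))) powr (1/2)"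
      using ne by (intro tendsto_intros s_lim) auto
    then show ?thesis by (intro tendsto_ennrealI) simp
  qed
  have "cmod (of_real x + \<alpha>) \<le> cmod (of_real x + (\<alpha> + \<i>))" for x
    using \<alpha> unfolding cmod_def by (auto intro!: real_sqrt_le_mono power_mono)
  then have "(\<integral>\<^sup>+x. ennreal (cmod (of_real x + \<alpha>) powr (1/2)) \<partial>cauchy_law \<gamma>)
      \<le> (\<integral>\<^sup>+x. ennreal (cmod (of_real x + (\<alpha> + \<i>)) powr (1/2)) \<partial>cauchy_law \<gamma>)"
    by (intro nn_integral_mono ennreal_leI powr_mono2) auto
  also have "\<dots> = (\<integral>\<^sup>+x. liminf (\<lambda>k. ennreal (cmod (inverse (s k + inverse (of_real x + (\<alpha> + \<i>)))) powr (1/2)))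
      \<partial>cauchy_law \<gamma>)"
    by (intro nn_integral_cong lim_imp_Liminf[symmetric] lim) simp
  also have "\<dots> \<le> liminf (\<lambda>k. \<integral>\<^sup>+x. ennreal (cmod (inverse (s k + inverse (of_real x + (\<alpha> + \<i>)))) powr (1/2))
      \<partial>cauchy_law \<gamma>)"
    by (intro nn_integral_liminf) measurable
  also have "\<dots> \<le> liminf (\<lambda>k::nat. ennreal C)"
    by (intro Liminf_mono always_eventually allI C s)
  also have "\<dots> = ennreal C" by (simp add: Liminf_const)
  also have "\<dots> < \<infinity>" by simp
  finally show ?thesis .
qed

section \<open>The three cases on the product space\<close>

lemma measurable_power_mean [measurable]:
  "(\<lambda>x. power_average p \<alpha> n (\<lambda>j. of_real (x j)) powr of_real a) \<in> borel_measurable (cauchy_product \<gamma> n)"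
  by (intro borel_measurable_powr_complex borel_measurable_power_average) auto

text \<open>Since nothing cancels in the sum, \<open>|G|\<close> is at least \<open>c |x\<^sub>i + \<alpha>|\<^sup>p\<close> for each \<open>i\<close>, with a
  constant \<open>c > 0\<close>; hence
  \<open>|G|\<^sup>1\<^sup>/\<^sup>p\<close> is at most \<open>c\<^sup>1\<^sup>/\<^sup>p |x\<^sub>i + \<alpha>|\<close>. A single such bound is not integrable; the geometric mean of
  the bounds for \<open>i = 1\<close> and \<open>i = 2\<close> is.\<close>

lemma integrable_power_mean:
  assumes \<gamma>: "Im \<gamma> > 0" and p: "-1 < p" "p < 0" and \<alpha>: "Im \<alpha> \<ge> 0" and n: "n \<ge> 2"
  shows "integrable (cauchy_product \<gamma> n) (\<lambda>x. power_average p \<alpha> n (\<lambda>j. of_real (x j)) powr of_real (1 / p))"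
proof -
  interpret N: prob_space "cauchy_law \<gamma>" by (rule prob_space_cauchy_law[OF \<gamma>])
  interpret product_sigma_finite "\<lambda>_::nat. cauchy_law \<gamma>" by unfold_locales
  define c where "c = cos (p * pi / 2) / n"
  have c: "c > 0" unfolding c_def using p n by (intro divide_pos_pos cos_half_pi_pos) auto
  let ?f = "\<lambda>i::nat. \<lambda>x. if i \<in> {1, 2} then cmod (of_real x + \<alpha>) powr (1/2) else 1"
  have "integrable (cauchy_law \<gamma>) (\<lambda>x. cmod (of_real x + \<alpha>) powr (1/2))"
    using half_moment_finite[OF \<gamma> \<alpha>] by (intro integrableI_bounded) auto
  then have "integrable (cauchy_law \<gamma>) (?f i)" for i
    by (cases "i \<in> {1, 2}") auto
  then have "integrable (cauchy_product \<gamma> n) (\<lambda>x. \<Prod>i\<in>{1..n}. ?f i (x i))"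
    by (intro product_integrable_prod) auto
  then have "integrable (cauchy_product \<gamma> n) (\<lambda>x. c powr (1 / p) * (\<Prod>i\<in>{1..n}. ?f i (x i)))"
    by (rule integrable_mult_right)
  then show ?thesis
  proof (rule Bochner_Integration.integrable_bound)
    show "AE x in cauchy_product \<gamma> n. norm (power_average p \<alpha> n (\<lambda>j. of_real (x j)) powr of_real (1 / p))
        \<le> norm (c powr (1 / p) * (\<Prod>i\<in>{1..n}. ?f i (x i)))"
      using AE_cauchy_product_nonzero[OF \<gamma>, of n \<alpha>]
    proof eventually_elim
      case (elim x)
      let ?G = "power_average p \<alpha> n (\<lambda>j. of_real (x j))" and ?z = "\<lambda>j. of_real (x j) + \<alpha>"
      have bound: "cmod ?G powr (1 / p) \<le> c powr (1 / p) * cmod (?z i)" if i: "i \<in> {1..n}" for i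
      proof -
        have zi: "cmod (?z i) > 0" using elim i by auto
        have "c * cmod (?z i) powr p \<le> c * (\<Sum>j=1..n. cmod (?z j) powr p)"
          using c i by (intro mult_left_mono member_le_sum) auto
        also have "\<dots> \<le> Re (?G * cnj (cis (p * pi / 2)))"
          unfolding c_def using p \<alpha> by (intro power_average_sector) auto
        also have "\<dots> \<le> cmod ?G"
          using complex_Re_le_cmod[of "?G * cnj (cis (p * pi / 2))"] by (simp add: norm_mult)
        finally have "cmod ?G powr (1 / p) \<le> (c * cmod (?z i) powr p) powr (1 / p)"
          using p c zi by (intro powr_mono2') auto
        also have "\<dots> = c powr (1 / p) * cmod (?z i)"
          using c zi p by (simp add: powr_mult powr_powr)
        finally show ?thesis .
      qed
      have "cmod ?G powr (1 / p) = (cmod ?G powr (1 / p)) powr (1/2) * (cmod ?G powr (1 / p)) powr (1/2)"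
        by (cases "?G = 0") (simp_all flip: powr_add)
      also have "\<dots> \<le> (c powr (1 / p) * cmod (?z 1)) powr (1/2) * (c powr (1 / p) * cmod (?z 2)) powr (1/2)"
        using n by (intro mult_mono powr_mono2 bound) auto
      also have "\<dots> = c powr (1 / p) * (cmod (?z 1) powr (1/2) * cmod (?z 2) powr (1/2))"
        using c by (simp add: powr_mult powr_powr flip: powr_add)
      also have "cmod (?z 1) powr (1/2) * cmod (?z 2) powr (1/2) = (\<Prod>i\<in>{1, 2}. ?f i (x i))"
        by simp
      also have "\<dots> = (\<Prod>i\<in>{1..n}. ?f i (x i))"
        using n by (intro prod.mono_neutral_left) auto
      finally show ?case
        by (simp add: norm_powr_real_powr' del: of_real_divide)
    qed
  qed measurable
qed

lemma power_average_minus_one: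
  "power_average (-1) \<alpha> n z = 1 / of_nat n * (\<Sum>j=1..n. inverse (z j + \<alpha>))"
  by (simp add: power_average_def powr_minus_one_complex)

text \<open>The exponent splits as \<open>3/4 + 1/4\<close>: the first part has to be below 1 for the fractional moment
  bound, and the second below 1/2, because it turns into twice that power of \<open>|z|\<close>.\<close>

lemma norm_powr_three_quarters:
  assumes w: "Im w > 0" and z: "z \<noteq> 0" and b: "b > 0" and le: "cmod w \<le> (cmod z)\<^sup>2 / b"
  shows "cmod w \<le> cmod w powr (3/4) * (b powr (-1/4) * cmod z powr (1/2))"
proof -
  have "w \<noteq> 0" using w by auto
  then have "cmod w = cmod w powr (3/4) * cmod w powr (1/4)"
    by (simp flip: powr_add)
  also have "\<dots> \<le> cmod w powr (3/4) * ((cmod z)\<^sup>2 / b) powr (1/4)"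
    using le by (intro mult_left_mono powr_mono2) auto
  also have "((cmod z)\<^sup>2 / b) powr (1/4) = b powr (-1/4) * cmod z powr (1/2)"
  proof -
    have "(cmod z)\<^sup>2 powr (1/4) = (cmod z powr 2) powr (1/4)" using z by simp
    also have "\<dots> = cmod z powr (1/2)" by (simp only: powr_powr) simp
    finally show ?thesis using b z by (simp add: powr_divide powr_minus_divide)
  qed
  finally show ?thesis .
qed

text \<open>
  With \<open>S\<close> the sum of \<open>1/(x\<^sub>j + \<alpha>)\<close> over \<open>j \<ge> 2\<close>, the harmonic mean is \<open>n h\<close> for
  \<open>h = 1/(S + 1/(x\<^sub>1 + \<alpha>))\<close>. The term \<open>j = 2\<close> alone gives \<open>|Im S| \<ge> Im \<alpha> / |x\<^sub>2 + \<alpha>|\<^sup>2\<close>, so that \<open>|h|\<close> is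
  at most a multiple of \<open>|h|\<^sup>3\<^sup>/\<^sup>4 |x\<^sub>2 + \<alpha>|\<^sup>1\<^sup>/\<^sup>2\<close>. Integrating over \<open>x\<^sub>1\<close> first disposes of \<open>|h|\<^sup>3\<^sup>/\<^sup>4\<close>
  uniformly in the other variables.
\<close>

lemma integrable_harmonic_mean:
  assumes \<gamma>: "Im \<gamma> > 0" and \<alpha>: "Im \<alpha> > 0" and n: "n \<ge> 2"
  shows "integrable (cauchy_product \<gamma> n) (\<lambda>x. power_average (-1) \<alpha> n (\<lambda>j. of_real (x j)) powr of_real (1 / - 1))"
proof (rule integrableI_bounded)
  interpret N: prob_space "cauchy_law \<gamma>" by (rule prob_space_cauchy_law[OF \<gamma>])
  interpret product_sigma_finite "\<lambda>_::nat. cauchy_law \<gamma>" by unfold_locales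
  obtain C where C: "\<And>s. Im s < 0 \<Longrightarrow>
      (\<integral>\<^sup>+x. ennreal (cmod (inverse (s + inverse (of_real x + \<alpha>))) powr (3/4)) \<partial>cauchy_law \<gamma>) \<le> ennreal C"
    using fractional_moment_uniform[OF \<gamma> \<alpha>, of "3/4"] by auto
  let ?F = "\<lambda>x. power_average (-1) \<alpha> n (\<lambda>j. of_real (x j)) powr of_real (1 / - 1)"
  define S where "S x = (\<Sum>j=2..n. inverse (complex_of_real (x j) + \<alpha>))" for x :: "nat \<Rightarrow> real"
  define K where "K = n * Im \<alpha> powr (-1/4)"
  have split: "{1..n} = insert 1 {2..n}" using n by auto
  have Im_inv: "Im (inverse (of_real t + \<alpha>)) = - (Im \<alpha> / (cmod (of_real t + \<alpha>))\<^sup>2)" for t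
    by (simp add: cmod_power2)
  have pos: "cmod (of_real t + \<alpha>) > 0" for t
    using \<alpha> by (auto simp: complex_eq_iff)
  have Im_S: "Im (S x) \<le> - (Im \<alpha> / (cmod (of_real (x 2) + \<alpha>))\<^sup>2)" for x
  proof -
    have "Im \<alpha> / (cmod (of_real (x 2) + \<alpha>))\<^sup>2 \<le> (\<Sum>j=2..n. Im \<alpha> / (cmod (of_real (x j) + \<alpha>))\<^sup>2)"
      using n \<alpha> by (intro member_le_sum) auto
    then show ?thesis by (simp add: S_def Im_sum Im_inv sum_negf del: inverse_complex.sel)
  qed
  have inner: "(\<integral>\<^sup>+y. ennreal (cmod (?F (x(1 := y)))) \<partial>cauchy_law \<gamma>)
      \<le> ennreal (K * C) * ennreal (cmod (of_real (x 2) + \<alpha>) powr (1/2))" for x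
  proof -
    let ?z = "of_real (x 2) + \<alpha>"
    define b where "b = Im \<alpha> / (cmod ?z)\<^sup>2"
    have b: "b > 0" unfolding b_def using \<alpha> pos[of "x 2"] by simp
    have Im_S': "Im (S x) < 0" using Im_S[of x] b unfolding b_def by linarith
    have le: "cmod (?F (x(1 := y))) \<le> K * cmod ?z powr (1/2) * cmod (inverse (S x + inverse (of_real y + \<alpha>))) powr (3/4)" for y
    proof -
      let ?w = "inverse (S x + inverse (of_real y + \<alpha>))"
      have "(\<Sum>j=1..n. inverse (complex_of_real ((x(1 := y)) j) + \<alpha>)) = S x + inverse (of_real y + \<alpha>)"
        unfolding split S_def by (subst sum.insert) (auto intro!: sum.cong)
      then have "?F (x(1 := y)) = of_nat n * ?w"
        unfolding power_average_minus_one by (simp add: powr_minus_one_complex divide_inverse)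
      then have eq: "cmod (?F (x(1 := y))) = n * cmod ?w"
        by (simp add: norm_mult)
      have Im: "Im (S x + inverse (of_real y + \<alpha>)) \<le> - b"
      proof -
        have "Im (S x + inverse (of_real y + \<alpha>)) = Im (S x) + Im (inverse (of_real y + \<alpha>))"
          by (rule plus_complex.sel(2))
        moreover have "Im \<alpha> / (cmod (of_real y + \<alpha>))\<^sup>2 > 0" using \<alpha> pos[of y] by simp
        ultimately show ?thesis using Im_S[of x] Im_inv[of y] unfolding b_def by linarith
      qed
      have "cmod ?w \<le> inverse b" using Im b by (rule norm_inverse_le_Im)
      then have "cmod ?w \<le> (cmod ?z)\<^sup>2 / Im \<alpha>" by (simp add: b_def)
      moreover have "Im ?w > 0" using Im b by (intro Im_inverse_pos) linarith
      ultimately have "cmod ?w \<le> cmod ?w powr (3/4) * (Im \<alpha> powr (-1/4) * cmod ?z powr (1/2))"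
        using \<alpha> pos[of "x 2"] by (intro norm_powr_three_quarters) auto
      then have "n * cmod ?w \<le> n * (cmod ?w powr (3/4) * (Im \<alpha> powr (-1/4) * cmod ?z powr (1/2)))"
        by (rule mult_left_mono) simp
      also have "\<dots> = K * cmod ?z powr (1/2) * cmod ?w powr (3/4)"
        by (simp add: K_def)
      finally show ?thesis unfolding eq .
    qed
    have "(\<integral>\<^sup>+y. ennreal (cmod (?F (x(1 := y)))) \<partial>cauchy_law \<gamma>) \<le>
        (\<integral>\<^sup>+y. ennreal (K * cmod ?z powr (1/2)) * ennreal (cmod (inverse (S x + inverse (of_real y + \<alpha>))) powr (3/4)) \<partial>cauchy_law \<gamma>)"
      by (intro nn_integral_mono) (use le in \<open>auto simp: K_def ennreal_leI simp flip: ennreal_mult\<close>)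
    also have "\<dots> = ennreal (K * cmod ?z powr (1/2)) *
        (\<integral>\<^sup>+y. ennreal (cmod (inverse (S x + inverse (of_real y + \<alpha>))) powr (3/4)) \<partial>cauchy_law \<gamma>)"
      by (intro nn_integral_cmult) measurable
    also have "\<dots> \<le> ennreal (K * cmod ?z powr (1/2)) * ennreal C"
      by (intro mult_left_mono C Im_S') auto
    also have "\<dots> = ennreal (K * C) * ennreal (cmod ?z powr (1/2))"
      by (simp add: K_def ennreal_mult' ennreal_mult'' mult_ac)
    finally show ?thesis .
  qed
  have "(\<integral>\<^sup>+x. ennreal (cmod (?F x)) \<partial>cauchy_product \<gamma> n) =
      (\<integral>\<^sup>+x. \<integral>\<^sup>+y. ennreal (cmod (?F (x(1 := y)))) \<partial>cauchy_law \<gamma> \<partial>PiM {2..n} (\<lambda>_. cauchy_law \<gamma>))"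
  proof -
    have "(\<lambda>x. ennreal (cmod (?F x))) \<in> borel_measurable (cauchy_product \<gamma> n)" by measurable
    then show ?thesis
      unfolding split by (intro product_nn_integral_insert) auto
  qed
  also have "\<dots> \<le> (\<integral>\<^sup>+x. ennreal (K * C) * ennreal (cmod (of_real (x 2) + \<alpha>) powr (1/2)) \<partial>PiM {2..n} (\<lambda>_. cauchy_law \<gamma>))"
    by (intro nn_integral_mono inner)
  also have "\<dots> = (\<integral>\<^sup>+t. ennreal (K * C) * ennreal (cmod (of_real t + \<alpha>) powr (1/2))
      \<partial>distr (PiM {2..n} (\<lambda>_. cauchy_law \<gamma>)) (cauchy_law \<gamma>) (\<lambda>x. x 2))"
    using n by (subst nn_integral_distr) auto
  also have "distr (PiM {2..n} (\<lambda>_. cauchy_law \<gamma>)) (cauchy_law \<gamma>) (\<lambda>x. x 2) = cauchy_law \<gamma>"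
    using n by (intro distr_PiM_component N.prob_space_axioms) auto
  also have "(\<integral>\<^sup>+t. ennreal (K * C) * ennreal (cmod (of_real t + \<alpha>) powr (1/2)) \<partial>cauchy_law \<gamma>) =
      ennreal (K * C) * (\<integral>\<^sup>+t. ennreal (cmod (of_real t + \<alpha>) powr (1/2)) \<partial>cauchy_law \<gamma>)"
    by (intro nn_integral_cmult) measurable
  also have "\<dots> < \<infinity>"
    using half_moment_finite[OF \<gamma> less_imp_le[OF \<alpha>]] by (simp add: ennreal_mult_less_top)
  finally show "(\<integral>\<^sup>+x. ennreal (cmod (?F x)) \<partial>cauchy_product \<gamma> n) < \<infinity>" .
qed measurable

text \<open>
  If the mean were integrable, its expectation would be \<open>\<gamma> + \<alpha>\<close>, although its values are real. For
  this the average \<open>A\<close> of the inverses must be nonzero almost surely. The regularised mean is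
  \<open>1/(A - i\<delta>)\<close>, with imaginary part \<open>\<delta>/(A\<^sup>2 + \<delta>\<^sup>2) \<ge> 0\<close>, which equals \<open>1/\<delta>\<close> where \<open>A = 0\<close>. As its
  expectation stays bounded when \<open>\<delta>\<close> tends to 0, the event \<open>A = 0\<close> has probability \<open>O(\<delta>)\<close>.
\<close>

lemma not_integrable_real_harmonic_mean:
  assumes \<gamma>: "Im \<gamma> > 0" and \<alpha>: "\<alpha> \<in> \<real>" and n: "n \<ge> 1"
  shows "\<not> integrable (cauchy_product \<gamma> n) (\<lambda>x. power_average (-1) \<alpha> n (\<lambda>j. of_real (x j)) powr of_real (1 / - 1))"
    (is "\<not> integrable _ ?F")
proof
  assume int: "integrable (cauchy_product \<gamma> n) ?F"
  interpret prob_space "cauchy_product \<gamma> n" by (rule prob_space_cauchy_product[OF \<gamma>])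
  let ?A = "\<lambda>x. power_average (-1) \<alpha> n (\<lambda>j. complex_of_real (x j))"
  let ?Z = "{x \<in> space (cauchy_product \<gamma> n). ?A x = 0}"
  have Im\<alpha>: "Im \<alpha> \<ge> 0" using \<alpha> by (simp add: complex_is_Real_iff)
  have real: "?A x \<in> \<real>" for x
    unfolding power_average_minus_one using \<alpha>
    by (intro Reals_mult sum_in_Reals Reals_inverse Reals_add Reals_of_real)
      (auto intro!: Reals_divide)
  have Z [measurable]: "?Z \<in> sets (cauchy_product \<gamma> n)"
    by measurable
  define c where "c = - Im (inverse (\<gamma> + \<alpha>))"
  have c: "c > 0" using Im_inverse_neg[of "\<gamma> + \<alpha>"] \<gamma> Im\<alpha> by (simp add: c_def)
  have reg: "regularised_mean (-1) \<alpha> n \<delta> z = inverse (power_average (-1) \<alpha> n z - \<i> * of_real \<delta>)" for \<delta> z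
    by (simp add: regularised_mean_def powr_minus_one_complex cis_minus_pi_half mult.commute)
  have prob_Z: "prob ?Z \<le> \<delta> * inverse c" if \<delta>: "\<delta> > 0" for \<delta>
  proof -
    let ?R = "\<lambda>x. regularised_mean (-1) \<alpha> n \<delta> (\<lambda>j. of_real (x j))"
    have int_R: "integrable (cauchy_product \<gamma> n) ?R"
      using \<delta> Im\<alpha> by (intro integrable_const_bound[where B = "\<delta> powr (1 / - 1)"] AE_I2
          norm_regularised_mean_le borel_measurable_regularised_mean) auto
    have "prob ?Z * inverse \<delta> = (\<integral>x. indicator ?Z x * inverse \<delta> \<partial>cauchy_product \<gamma> n)"
      by simp
    also have "\<dots> \<le> (\<integral>x. Im (?R x) \<partial>cauchy_product \<gamma> n)"
    proof (intro integral_mono integrable_Im int_R)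
      show "integrable (cauchy_product \<gamma> n) (\<lambda>x. indicator ?Z x * inverse \<delta>)"
        by (intro integrable_mult_left integrable_real_indicator Z)
          (simp only: infinity_ennreal_def less_top[symmetric] emeasure_finite not_False_eq_True)
      fix x
      obtain t where t: "?A x = of_real t" using real[of x] by (auto elim: Reals_cases)
      then have "Im (?R x) = \<delta> / (t\<^sup>2 + \<delta>\<^sup>2)" by (simp add: reg)
      moreover have "indicator ?Z x * inverse \<delta> \<le> \<delta> / (t\<^sup>2 + \<delta>\<^sup>2)"
        using \<delta> t by (cases "t = 0") (auto simp: indicator_def power2_eq_square inverse_eq_divide)
      ultimately show "indicator ?Z x * inverse \<delta> \<le> Im (?R x)" by simp
    qed
    also have "\<dots> = Im (regularised_mean (-1) \<alpha> n \<delta> (\<lambda>_. \<gamma>))"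
      using int_R expectation_regularised_mean[OF \<gamma> _ _ \<delta> Im\<alpha>, of "-1" n] by simp
    also have "\<dots> \<le> cmod (regularised_mean (-1) \<alpha> n \<delta> (\<lambda>_. \<gamma>))" by (rule order_trans[OF abs_ge_self abs_Im_le_cmod])
    also have "\<dots> \<le> inverse c"
      unfolding reg using \<delta> c n
      by (intro norm_inverse_le_Im) (simp_all add: power_average_const powr_minus_one_complex c_def)
    finally show ?thesis using \<delta> by (simp add: field_simps)
  qed
  have "prob ?Z \<le> 0 + e" if "e > 0" for e
  proof -
    have "e * c * inverse c = e" using c by simp
    then show ?thesis using prob_Z[of "e * c"] that c by (simp only: mult_pos_pos add_0)
  qed
  then have "prob ?Z \<le> 0" by (rule field_le_epsilon)
  then have "AE x in cauchy_product \<gamma> n. ?A x \<noteq> 0"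
  proof -
    from \<open>prob ?Z \<le> 0\<close> have "prob ?Z = 0" by (intro antisym measure_nonneg)
    then have "AE x in cauchy_product \<gamma> n. x \<notin> ?Z" by (simp only: prob_eq_0[OF Z])
    then show ?thesis using AE_space by eventually_elim simp
  qed
  then have "(\<integral>x. ?F x \<partial>cauchy_product \<gamma> n) = \<gamma> + \<alpha>"
    using n by (intro expectation_power_mean \<gamma> Im\<alpha> int) auto
  moreover have "Im (\<integral>x. ?F x \<partial>cauchy_product \<gamma> n) = (\<integral>x. Im (?F x) \<partial>cauchy_product \<gamma> n)"
    using int by simp
  moreover have "Im (?F x) = 0" for x
    using Reals_inverse[OF real[of x]] by (simp add: powr_minus_one_complex complex_is_Real_iff)
  ultimately have "Im (\<gamma> + \<alpha>) = 0" by simp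
  then show False using \<gamma> Im\<alpha> by simp
qed

section \<open>Shifted power means of independent Cauchy variables\<close>

lemma joint_law_cauchy:
  assumes "prob_space M" and "prob_space.indep_vars M (\<lambda>_. borel) X {1..}"
    and dist: "\<And>j. j \<ge> 1 \<Longrightarrow> distributed M lborel (X j) (\<lambda>x. ennreal (cauchy_density \<gamma> x))"
    and n: "n \<ge> 1"
  shows "distr M (cauchy_product \<gamma> n) (\<lambda>\<omega>. \<lambda>j\<in>{1..n}. X j \<omega>) = cauchy_product \<gamma> n"
    and "(\<lambda>\<omega>. \<lambda>j\<in>{1..n}. X j \<omega>) \<in> M \<rightarrow>\<^sub>M cauchy_product \<gamma> n"
proof -
  interpret prob_space M by fact
  have meas: "X j \<in> borel_measurable M" if "j \<in> {1..n}" for j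
    using distributed_measurable[OF dist, of j] that by simp
  have law: "distr M borel (X j) = cauchy_law \<gamma>" if "j \<in> {1..n}" for j
  proof -
    have "distr M borel (X j) = distr M lborel (X j)" by (rule distr_cong) auto
    then show ?thesis
      using distributed_distr_eq_density[OF dist, of j] that by (simp add: cauchy_law_def)
  qed
  have "indep_vars (\<lambda>_. borel) X {1..n}"
    using assms(2) by (rule indep_vars_subset) auto
  then have prod: "distr M (PiM {1..n} (\<lambda>_. borel)) (\<lambda>\<omega>. \<lambda>j\<in>{1..n}. X j \<omega>) = PiM {1..n} (\<lambda>j. distr M borel (X j))"
    using n meas by (subst (asm) indep_vars_iff_distr_eq_PiM') auto
  have "distr M (cauchy_product \<gamma> n) (\<lambda>\<omega>. \<lambda>j\<in>{1..n}. X j \<omega>) =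
      distr M (PiM {1..n} (\<lambda>_. borel)) (\<lambda>\<omega>. \<lambda>j\<in>{1..n}. X j \<omega>)"
    by (rule distr_cong[OF refl sets_PiM_cong]) simp_all
  also note prod
  also have "PiM {1..n} (\<lambda>j. distr M borel (X j)) = cauchy_product \<gamma> n"
    by (rule PiM_cong) (auto simp: law)
  finally show "distr M (cauchy_product \<gamma> n) (\<lambda>\<omega>. \<lambda>j\<in>{1..n}. X j \<omega>) = cauchy_product \<gamma> n" .
  show "(\<lambda>\<omega>. \<lambda>j\<in>{1..n}. X j \<omega>) \<in> M \<rightarrow>\<^sub>M cauchy_product \<gamma> n"
    using meas by (intro measurable_restrict) simp
qed

lemma shifted_power_mean_eq:
  "shifted_power_mean p \<alpha> X n \<omega> =
    power_average p \<alpha> n (\<lambda>j. of_real ((\<lambda>j\<in>{1..n}. X j \<omega>) j)) powr of_real (1 / p) - \<alpha>"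
  by (simp add: shifted_power_mean_def power_average_def)

theorem theorem7p1:
  fixes M :: "'a measure" and X :: "nat \<Rightarrow> 'a \<Rightarrow> real" and \<gamma> :: complex and n :: nat
  assumes "prob_space M"
    and "Im \<gamma> > 0"
    and "prob_space.indep_vars M (\<lambda>_. borel) X {1..}"
    and "\<And>j. j \<ge> 1 \<Longrightarrow> distributed M lborel (X j) (\<lambda>x. ennreal (cauchy_density \<gamma> x))"
    and "n \<ge> 2"
  shows
    "(\<forall>p \<alpha>. -1 < p \<and> p < 0 \<and> Im \<alpha> \<ge> 0 \<longrightarrow>
        integrable M (shifted_power_mean p \<alpha> X n) \<and>
        prob_space.expectation M (shifted_power_mean p \<alpha> X n) = \<gamma>) \<and>
     (\<forall>\<alpha>\<in>\<real>. \<not> integrable M (shifted_power_mean (-1) \<alpha> X n)) \<and>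
     (\<forall>\<alpha>. Im \<alpha> > 0 \<longrightarrow>
        integrable M (shifted_power_mean (-1) \<alpha> X n) \<and>
        prob_space.expectation M (shifted_power_mean (-1) \<alpha> X n) = \<gamma>)"
proof -
  interpret prob_space M by fact
  interpret P: prob_space "cauchy_product \<gamma> n" by (rule prob_space_cauchy_product[OF assms(2)])
  let ?F = "\<lambda>p \<alpha> x. power_average p \<alpha> n (\<lambda>j. of_real (x j)) powr of_real (1 / p)"
  have n: "n \<ge> 1" using assms(5) by simp
  have law: "distr M (cauchy_product \<gamma> n) (\<lambda>\<omega>. \<lambda>j\<in>{1..n}. X j \<omega>) = cauchy_product \<gamma> n"
    "(\<lambda>\<omega>. \<lambda>j\<in>{1..n}. X j \<omega>) \<in> M \<rightarrow>\<^sub>M cauchy_product \<gamma> n"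
    by (rule joint_law_cauchy; fact)+
  have integrable_iff: "integrable M (shifted_power_mean p \<alpha> X n) \<longleftrightarrow> integrable (cauchy_product \<gamma> n) (?F p \<alpha>)"
    for p \<alpha>
  proof -
    have "integrable M (shifted_power_mean p \<alpha> X n) \<longleftrightarrow>
        integrable M (\<lambda>\<omega>. ?F p \<alpha> (\<lambda>j\<in>{1..n}. X j \<omega>))"
    proof
      assume "integrable M (shifted_power_mean p \<alpha> X n)"
      then have "integrable M (\<lambda>\<omega>. shifted_power_mean p \<alpha> X n \<omega> + \<alpha>)"
        by (rule Bochner_Integration.integrable_add) simp
      then show "integrable M (\<lambda>\<omega>. ?F p \<alpha> (\<lambda>j\<in>{1..n}. X j \<omega>))"
        by (simp only: shifted_power_mean_eq diff_add_cancel)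
    next
      assume "integrable M (\<lambda>\<omega>. ?F p \<alpha> (\<lambda>j\<in>{1..n}. X j \<omega>))"
      then show "integrable M (shifted_power_mean p \<alpha> X n)"
        unfolding shifted_power_mean_eq[abs_def] by (rule Bochner_Integration.integrable_diff) simp
    qed
    also have "\<dots> \<longleftrightarrow> integrable (distr M (cauchy_product \<gamma> n) (\<lambda>\<omega>. \<lambda>j\<in>{1..n}. X j \<omega>)) (?F p \<alpha>)"
      by (rule integrable_distr_eq[symmetric, OF law(2) measurable_power_mean])
    finally show ?thesis by (simp only: law)
  qed
  have expectation_eq: "expectation (shifted_power_mean p \<alpha> X n) = (\<integral>x. ?F p \<alpha> x \<partial>cauchy_product \<gamma> n) - \<alpha>"
    if "integrable (cauchy_product \<gamma> n) (?F p \<alpha>)" for p \<alpha>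
  proof -
    have int: "integrable M (\<lambda>\<omega>. ?F p \<alpha> (\<lambda>j\<in>{1..n}. X j \<omega>))"
      using that by (subst integrable_distr_eq[symmetric, OF law(2) measurable_power_mean]) (simp only: law)
    have "expectation (shifted_power_mean p \<alpha> X n) = expectation (\<lambda>\<omega>. ?F p \<alpha> (\<lambda>j\<in>{1..n}. X j \<omega>)) - \<alpha>"
      unfolding shifted_power_mean_eq[abs_def] using int
      by (subst Bochner_Integration.integral_diff) (auto simp: prob_space)
    also have "expectation (\<lambda>\<omega>. ?F p \<alpha> (\<lambda>j\<in>{1..n}. X j \<omega>)) =
        (\<integral>x. ?F p \<alpha> x \<partial>distr M (cauchy_product \<gamma> n) (\<lambda>\<omega>. \<lambda>j\<in>{1..n}. X j \<omega>))"
      by (rule integral_distr[symmetric, OF law(2) measurable_power_mean])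
    finally show ?thesis by (simp only: law)
  qed
  have "integrable (cauchy_product \<gamma> n) (?F p \<alpha>) \<and> (\<integral>x. ?F p \<alpha> x \<partial>cauchy_product \<gamma> n) = \<gamma> + \<alpha>"
    if p: "-1 < p" "p < 0" and \<alpha>: "Im \<alpha> \<ge> 0" for p \<alpha>
  proof -
    have int: "integrable (cauchy_product \<gamma> n) (?F p \<alpha>)"
      by (rule integrable_power_mean) fact+
    have "AE x in cauchy_product \<gamma> n. power_average p \<alpha> n (\<lambda>j. of_real (x j)) \<notin> \<real>\<^sub>\<le>\<^sub>0"
      using AE_cauchy_product_nonzero[OF assms(2), of n \<alpha>]
      by eventually_elim (use p n \<alpha> in \<open>intro power_average_not_nonpos; auto\<close>)
    then have "AE x in cauchy_product \<gamma> n. power_average p \<alpha> n (\<lambda>j. of_real (x j)) \<noteq> 0 \<and>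
        (p = -1 \<or> power_average p \<alpha> n (\<lambda>j. of_real (x j)) \<notin> \<real>\<^sub>\<le>\<^sub>0)"
      by eventually_elim auto
    then show ?thesis
      using int expectation_power_mean[OF assms(2) _ p(2) \<alpha> n int] p by simp
  qed
  moreover have "integrable (cauchy_product \<gamma> n) (?F (-1) \<alpha>) \<and> (\<integral>x. ?F (-1) \<alpha> x \<partial>cauchy_product \<gamma> n) = \<gamma> + \<alpha>"
    if \<alpha>: "Im \<alpha> > 0" for \<alpha>
  proof -
    have int: "integrable (cauchy_product \<gamma> n) (?F (-1) \<alpha>)"
      by (rule integrable_harmonic_mean) fact+
    have "power_average (-1) \<alpha> n (\<lambda>j. of_real (x j)) \<noteq> 0" for x
    proof -
      have "(\<Sum>j=1..n. Im (inverse (of_real (x j) + \<alpha>))) < (\<Sum>j=1..n. 0)"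
        using n by (intro sum_strict_mono Im_inverse_neg) (auto simp: \<alpha>)
      then have "Im (\<Sum>j=1..n. inverse (of_real (x j) + \<alpha>)) \<noteq> Im 0"
        unfolding Im_sum by simp
      then have "(\<Sum>j=1..n. inverse (of_real (x j) + \<alpha>)) \<noteq> 0" by metis
      then show ?thesis using n unfolding power_average_minus_one by simp
    qed
    then show ?thesis
      using int \<alpha> n by (intro conjI expectation_power_mean assms(2)) auto
  qed
  moreover have "\<not> integrable (cauchy_product \<gamma> n) (?F (-1) \<alpha>)" if "\<alpha> \<in> \<real>" for \<alpha>
    by (rule not_integrable_real_harmonic_mean) fact+
  ultimately show ?thesis
    unfolding integrable_iff using expectation_eq by auto
qed

end
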